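(* Let $\widehat\Theta=\widehat\Theta(Y)$ be a $T$-valued decoder satisfying, under the joint law of $(\Theta,Y)$, the approximate residual comparison \[ \|Y-v_{\widehat\Theta(Y)}\|^2\le\|Y-v_\Theta\|^2+\varepsilon_{\rm up} \] for some nonnegative random variable $\varepsilon_{\rm up}$. (For instance, this holds with $\varepsilon_{\rm up}=\varepsilon_{\rm opt}+\varepsilon_{\rm pen}$ whenever there are a penalty $\Omega:T\to\mathbb R$ and nonnegative integrable $\varepsilon_{\rm opt},\varepsilon_{\rm pen}$ with $\|Y-v_{\widehat\Theta}\|^2+\Omega(\widehat\Theta)\le\|Y-v_\Theta\|^2+\Omega(\Theta)+\varepsilon_{\rm opt}$ and $\Omega(\widehat\Theta)\ge\Omega(\Theta)-\varepsilon_{\rm pen}$.) Suppose that a deterministic envelope $A:T\to[0,\infty)$ satisfies \[ \mathbb P_Z\{\forall t\in T:\ |X_t|\le A(t)\}\ge1-\delta . \] Then, with probability at least $1-\delta$ under the joint law of $(\Theta,Y)$, \[ d(\Theta,\widehat\Theta(Y))^2\le2\tau\bigl(A(\Theta)+A(\widehat\Theta(Y))\bigr)+\varepsilon_{\rm up}. \] Consequently, if $D_T:=\sup_{s,t\in T}d(s,t)<\infty$, then \[ \mathbb E\,d(\Theta,\widehat\Theta(Y))\le\mathbb E\sqrt{2\tau\bigl(A(\Theta)+A(\widehat\Theta(Y))\bigr)+\varepsilon_{\rm up}}+\delta D_T . \] In particular, after adjoining an anchor point $t_0$ with $v_{t_0}=0$ and $X_{t_0}=0$ if necessary, one may take $A(t)=A_{\mu,r_0,s_0}(t;\delta)$,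 the pointwise Gaussian envelope defined in the context, with the prior $\mu$ extended to $T\cup\{t_0\}$, for instance as $\bar\mu=\frac12\delta_{t_0}+\frac12\mu$, which changes the pointwise functional $\Phi_\mu$ on $T$ only by universal constants. This yields a pointwise-complexity upper bound for the estimation risk.
   Context: $T$ is a finite set, $v:T\to\mathcal H$ an embedding into a finite-dimensional Hilbert space, $d(s,t):=\|v_s-v_t\|$. $\pi$ is a probability measure on $T$, $\tau>0$, $\delta\in(0,1)$, and \[ Y=v_\Theta+\tau Z,\qquad\Theta\sim\pi,\qquad Z\sim N(0,I_{\mathcal H}) \] with $\Theta,Z$ independent; $X_t:=\langle Z,v_t\rangle$. Pointwise Gaussian envelope: let $T_0:=T\cup\{t_0\}$ with $v_{t_0}=0$ (or $T_0=T$ if such a point is already present), with $d$ and $X$ extended to $T_0$ by the same formulas. Put $\sigma(t):=d(t,t_0)=\|v_t\|$, $R_\ast:=\sup_{t\in T_0}\sigma(t)$ (assumed to satisfy $0<R_\ast<\infty$), $B_d(t,\varepsilon):=\{s\in T_0:d(s,t)\le\varepsilon\}$. For a prior $\mu$ (a probability measure; when $\mu$ is given on $T$ it is extended to $T_0$ as in the claim), \[ \Phi_{\mu}(t):=\int_0^{4\sigma(t)}\sqrt{\log\frac1{\mu(B_d(t,\varepsilon))}}\,d\varepsilon,\qquad\Phi_{\mu,\ast}:=\sup_{t\in T_0}\Phi_{\mu}(t)\ \text{(assumed finite)}. \] For $r_0>0$, $s_0\in(0,R_\ast]$, with $\log_2^+(u)=\max\{\log_2u,0\}$, \[ M_{r_0,s_0}:=\bigl(1+\lceil\log_2^+(\Phi_{\mu,\ast}/r_0)\rceil\bigr)\bigl(1+\lceil\log_2(R_\ast/s_0)\rceil\bigr),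 \] \[ A_{\mu,r_0,s_0}(t;\delta):=C\left[\max\{\Phi_{\mu}(t),r_0\}+\max\{\sigma(t),s_0\}\sqrt{\log\frac{2eM_{r_0,s_0}}{\delta}}\right], \] where $C>0$ is a suitable absolute constant.
   Formalization: "Changes Φ_μ only by universal constants" fails multiplicatively (T={t}, μ=δ_t gives Φ_μ(t)=0 but Φ_μ̄(t)>0), so what is stated is Φ_μ̄(t) ≤ Φ_μ(t)+4√(log 2)·σ(t) and Φ_μ(t) ≤ 4Φ_μ̄(t) for t in T. *)

theory Defs
  imports "HOL-Probability.Probability"
begin

text \<open>The standard Gaussian measure \<open>N(0, I)\<close> on a finite-dimensional Hilbert space.\<close>

definition std_gaussian :: "'h::euclidean_space measure" where
  "std_gaussian =
     density lborel (\<lambda>z. ennreal (exp (- (norm z)\<^sup>2 / 2) / sqrt (2 * pi) ^ DIM('h)))"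

text \<open>
  The approximate residual comparison, almost surely with respect to the underlying probability
  space \<open>M\<close>; the error \<open>\<epsilon>\<close> is a nonnegative random variable on \<open>M\<close> and
  need not be integrable.
\<close>

definition residual_comparison ::
  "'w measure \<Rightarrow> ('t \<Rightarrow> 'h::euclidean_space) \<Rightarrow> ('w \<Rightarrow> 't) \<Rightarrow> ('w \<Rightarrow> 'h) \<Rightarrow> ('h \<Rightarrow> 't) \<Rightarrow> ('w \<Rightarrow> real) \<Rightarrow> bool"
  where
  "residual_comparison M v \<Theta> Y dec \<epsilon> \<longleftrightarrow>
     \<epsilon> \<in> borel_measurable M \<and> (AE \<omega> in M. 0 \<le> \<epsilon> \<omega>) \<and>
     (AE \<omega> in M. (norm (Y \<omega> - v (dec (Y \<omega>))))\<^sup>2 \<le> (norm (Y \<omega> - v (\<Theta> \<omega>)))\<^sup>2 + \<epsilon> \<omega>)"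

text \<open>
  Adjoining an anchor: the extended index set lives in the option type, with \<open>None\<close> mapped
  to the zero vector. If some \<open>t \<in> T\<close> already has \<open>v t = 0\<close>, that point is the
  anchor and no point is added (so \<open>anchored_set v T = Some ` T\<close>).
\<close>

definition anchored_map :: "('t \<Rightarrow> 'h::euclidean_space) \<Rightarrow> 't option \<Rightarrow> 'h" where
  "anchored_map v = case_option 0 v"

definition anchor :: "('t \<Rightarrow> 'h::euclidean_space) \<Rightarrow> 't set \<Rightarrow> 't option" where
  "anchor v T = (if \<exists>t\<in>T. v t = 0 then Some (THE t. t \<in> T \<and> v t = 0) else None)"

definition anchored_set :: "('t \<Rightarrow> 'h::euclidean_space) \<Rightarrow> 't set \<Rightarrow> 't option set" where
  "anchored_set v T = insert (anchor v T) (Some ` T)"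

text \<open>A prior on \<open>T\<close> viewed on the extended set is \<open>map_pmf Some \<mu>\<close>; the following is
  \<open>1/2 \<delta>\<^sub>t\<^sub>0 + 1/2 \<mu>\<close>.\<close>

definition anchored_prior ::
  "('t \<Rightarrow> 'h::euclidean_space) \<Rightarrow> 't set \<Rightarrow> 't pmf \<Rightarrow> 't option pmf" where
  "anchored_prior v T \<mu> =
     bind_pmf (bernoulli_pmf (1/2)) (\<lambda>b. if b then return_pmf (anchor v T) else map_pmf Some \<mu>)"

text \<open>The next definitions are applied to an anchored family, where
  \<open>\<sigma>(t) = d(t, t\<^sub>0) = norm (v t)\<close>.\<close>

definition dball :: "('s \<Rightarrow> 'h::euclidean_space) \<Rightarrow> 's set \<Rightarrow> 's \<Rightarrow> real \<Rightarrow> 's set" where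
  "dball v S t \<epsilon> = {s \<in> S. dist (v s) (v t) \<le> \<epsilon>}"

text \<open>\<open>sqrt (log (1 / p))\<close> with the convention \<open>log (1 / 0) = \<infinity>\<close>, which is not the
  convention of \<open>ln\<close> on the reals.\<close>

definition sqrt_log_inv :: "real \<Rightarrow> ennreal" where
  "sqrt_log_inv p = (if p = 0 then \<infinity> else ennreal (sqrt (ln (1 / p))))"

definition pw_functional ::
  "('s \<Rightarrow> 'h::euclidean_space) \<Rightarrow> 's set \<Rightarrow> 's pmf \<Rightarrow> 's \<Rightarrow> ennreal" where
  "pw_functional v S \<mu> t =
     (\<integral>\<^sup>+\<epsilon>\<in>{0..4 * norm (v t)}. sqrt_log_inv (measure_pmf.prob \<mu> (dball v S t \<epsilon>)) \<partial>lborel)"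

definition sup_functional :: "('s \<Rightarrow> 'h::euclidean_space) \<Rightarrow> 's set \<Rightarrow> 's pmf \<Rightarrow> ennreal" where
  "sup_functional v S \<mu> = (SUP t\<in>S. pw_functional v S \<mu> t)"

definition sup_radius :: "('s \<Rightarrow> 'h::euclidean_space) \<Rightarrow> 's set \<Rightarrow> real" where
  "sup_radius v S = (SUP t\<in>S. norm (v t))"

definition num_levels ::
  "('s \<Rightarrow> 'h::euclidean_space) \<Rightarrow> 's set \<Rightarrow> 's pmf \<Rightarrow> real \<Rightarrow> real \<Rightarrow> int" where
  "num_levels v S \<mu> r\<^sub>0 s\<^sub>0 =
     (1 + \<lceil>max (log 2 (enn2real (sup_functional v S \<mu>) / r\<^sub>0)) 0\<rceil>) *
     (1 + \<lceil>log 2 (sup_radius v S / s\<^sub>0)\<rceil>)"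

definition gaussian_envelope ::
  "real \<Rightarrow> ('s \<Rightarrow> 'h::euclidean_space) \<Rightarrow> 's set \<Rightarrow> 's pmf \<Rightarrow> real \<Rightarrow> real \<Rightarrow> real \<Rightarrow> 's \<Rightarrow> real" where
  "gaussian_envelope C v S \<mu> r\<^sub>0 s\<^sub>0 \<delta> t =
     C * (max (enn2real (pw_functional v S \<mu> t)) r\<^sub>0 +
          max (norm (v t)) s\<^sub>0 *
            sqrt (ln (2 * exp 1 * real_of_int (num_levels v S \<mu> r\<^sub>0 s\<^sub>0) / \<delta>)))"

end

theory Submission
  imports Defs
begin

text \<open>
  The envelope bound follows Fernique's averaging argument, without nets, union bounds or Gaussian
  concentration. The random variable
  \<open>W = \<Sum>x,y. \<nu>(x) \<nu>(y) exp ((X\<^sub>x - X\<^sub>y)\<^sup>2 / (4 d(x,y)\<^sup>2)) + \<Sum>x. \<nu>(x) exp (X\<^sub>x\<^sup>2 / (4 \<sigma>(x)\<^sup>2))\<close>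
  has mean at most \<open>2 \<surd>2\<close>, so \<open>W \<le> 2 \<surd>2 / \<delta>\<close> with probability at least \<open>1 - \<delta>\<close>. On that event Jensen's
  inequality bounds the difference of the \<open>\<nu>\<close>-means of \<open>X\<close> over two balls \<open>B\<close>, \<open>B'\<close> by
  \<open>2 D \<surd>ln (W / (\<nu>(B) \<nu>(B')))\<close>, where \<open>D\<close> bounds the distances between points of \<open>B\<close> and \<open>B'\<close>.
  Telescoping over the balls of radius \<open>\<sigma>(t) / 2\<^sup>n\<close> around \<open>t\<close> gives
  \<open>\<bar>X\<^sub>t\<bar> \<le> 26 \<Phi>\<^sub>\<nu>(t) + 10 \<sigma>(t) \<surd>ln (2 \<surd>2 / \<delta>)\<close> for all \<open>t\<close> at once, which is stronger than the
  claimed envelope. For the decoder, expanding \<open>Y = v\<^sub>\<Theta> + \<tau> Z\<close> in the residual comparison leaves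
  \<open>d\<^sup>2 \<le> 2 \<tau> \<langle>Z, v\<^sub>d\<^sub>e\<^sub>c - v\<^sub>\<Theta>\<rangle> + \<epsilon>\<close>.
\<close>

section \<open>Gaussian exponential moments\<close>

lemma sets_std_gaussian [simp, measurable_cong]: "sets std_gaussian = sets borel"
  by (simp add: std_gaussian_def)

lemma space_std_gaussian [simp]: "space std_gaussian = UNIV"
  by (simp add: std_gaussian_def)

lemma nn_integral_std_normal_density: "(\<integral>\<^sup>+x. ennreal (normal_density \<mu> \<sigma> x) \<partial>lborel) = 1" if "0 < \<sigma>"
  using that by (simp add: nn_integral_eq_integral)

lemma nn_integral_std_gaussian:
  assumes [measurable]: "f \<in> borel_measurable borel"
  shows "(\<integral>\<^sup>+z. f z \<partial>(std_gaussian :: 'h::euclidean_space measure)) =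
    (\<integral>\<^sup>+z. ennreal (exp (- (norm z)\<^sup>2 / 2) / sqrt (2 * pi) ^ DIM('h)) * f z \<partial>lborel)"
  unfolding std_gaussian_def by (subst nn_integral_density) auto

text \<open>The density factors over the orthonormal basis, so its integral is a product of
  one-dimensional standard normal integrals.\<close>

lemma prob_space_std_gaussian: "prob_space (std_gaussian :: 'h::euclidean_space measure)"
proof
  have "exp (- (norm z)\<^sup>2 / 2) / sqrt (2 * pi) ^ DIM('h) = (\<Prod>b\<in>Basis. std_normal_density (z \<bullet> b))"
    for z :: 'h
  proof -
    have "(norm z)\<^sup>2 = (\<Sum>b\<in>Basis. (z \<bullet> b)\<^sup>2)"
      unfolding power2_norm_eq_inner by (subst euclidean_inner) (simp add: power2_eq_square)
    then have "exp (- (norm z)\<^sup>2 / 2) = (\<Prod>b\<in>Basis. exp (- (z \<bullet> b)\<^sup>2 / 2))"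
      by (simp add: exp_sum[symmetric] sum_negf[symmetric] sum_divide_distrib)
    moreover have "std_normal_density x = exp (- x\<^sup>2 / 2) / sqrt (2 * pi)" for x
      by (simp add: std_normal_density_def)
    ultimately show ?thesis
      by (simp only: prod_dividef prod_constant)
  qed
  then have "emeasure (std_gaussian :: 'h measure) UNIV
      = (\<integral>\<^sup>+z. ennreal (\<Prod>b\<in>Basis. std_normal_density (z \<bullet> b)) \<partial>(lborel :: 'h measure))"
    by (simp add: std_gaussian_def emeasure_density)
  also have "\<dots> = (\<integral>\<^sup>+z. (\<Prod>b\<in>Basis. ennreal (std_normal_density (z \<bullet> b))) \<partial>(lborel :: 'h measure))"
    by (simp add: prod_ennreal)
  also have "\<dots> = 1"
    by (subst nn_integral_lborel_prod) (auto simp: nn_integral_std_normal_density)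
  finally show "emeasure (std_gaussian :: 'h measure) (space std_gaussian) = 1"
    by simp
qed

text \<open>Completing the square reduces this to translation invariance of Lebesgue measure.\<close>

lemma std_gaussian_mgf:
  fixes u :: "'h::euclidean_space"
  shows "(\<integral>\<^sup>+z. ennreal (exp (z \<bullet> u)) \<partial>std_gaussian) = ennreal (exp ((norm u)\<^sup>2 / 2))"
proof -
  define \<phi> where "\<phi> z = exp (- (norm z)\<^sup>2 / 2) / sqrt (2 * pi) ^ DIM('h)" for z :: 'h
  have [measurable]: "\<phi> \<in> borel_measurable borel"
    unfolding \<phi>_def by measurable
  have "(\<integral>\<^sup>+z. ennreal (exp (z \<bullet> u)) \<partial>std_gaussian)
      = (\<integral>\<^sup>+z. ennreal (\<phi> z) * ennreal (exp (z \<bullet> u)) \<partial>lborel)"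
    unfolding \<phi>_def by (rule nn_integral_std_gaussian) measurable
  also have "\<dots> = (\<integral>\<^sup>+z. ennreal (\<phi> z) * ennreal (exp (z \<bullet> u)) \<partial>distr lborel borel ((+) u))"
    by (simp add: lborel_distr_plus)
  also have "\<dots> = (\<integral>\<^sup>+z. ennreal (\<phi> (u + z)) * ennreal (exp ((u + z) \<bullet> u)) \<partial>lborel)"
    by (rule nn_integral_distr) auto
  also have "\<dots> = (\<integral>\<^sup>+z. ennreal (exp ((norm u)\<^sup>2 / 2)) * ennreal (\<phi> z) \<partial>lborel)"
  proof (rule nn_integral_cong)
    fix z
    have *: "- (norm (u + z))\<^sup>2 / 2 + (u + z) \<bullet> u = (norm u)\<^sup>2 / 2 + - (norm z)\<^sup>2 / 2"
      by (simp add: power2_norm_eq_inner inner_add_left inner_add_right inner_commute field_simps)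
    have "\<phi> (u + z) * exp ((u + z) \<bullet> u) = exp ((norm u)\<^sup>2 / 2) * \<phi> z"
      by (simp only: \<phi>_def times_divide_eq_left times_divide_eq_right exp_add[symmetric] *)
    moreover have "0 \<le> \<phi> z" "0 \<le> \<phi> (u + z)"
      by (simp_all add: \<phi>_def)
    ultimately show "ennreal (\<phi> (u + z)) * ennreal (exp ((u + z) \<bullet> u)) = ennreal (exp ((norm u)\<^sup>2 / 2)) * ennreal (\<phi> z)"
      by (simp add: ennreal_mult[symmetric])
  qed
  also have "\<dots> = ennreal (exp ((norm u)\<^sup>2 / 2)) * (\<integral>\<^sup>+z. ennreal (\<phi> z) \<partial>lborel)"
    by (rule nn_integral_cmult) measurable
  also have "(\<integral>\<^sup>+z. ennreal (\<phi> z) \<partial>lborel) = emeasure std_gaussian (space (std_gaussian :: 'h measure))"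
    by (simp add: std_gaussian_def emeasure_density \<phi>_def)
  also have "\<dots> = 1"
    by (rule prob_space.emeasure_space_1[OF prob_space_std_gaussian])
  finally show ?thesis by simp
qed

text \<open>Multiplying the N(0, 1) density by exp (x^2 / 4) gives sqrt 2 times the density of N(0,
  2).\<close>

lemma nn_integral_exp_quarter_square:
  "(\<integral>\<^sup>+x. ennreal (exp (x\<^sup>2 / 4)) \<partial>(std_gaussian :: real measure)) = ennreal (sqrt 2)"
proof -
  have "exp (- x\<^sup>2 / 2) / sqrt (2 * pi) * exp (x\<^sup>2 / 4) = sqrt 2 * normal_density 0 (sqrt 2) x" for x :: real
  proof -
    have "- x\<^sup>2 / 2 + x\<^sup>2 / 4 = - x\<^sup>2 / 4" by simp
    then have "exp (- x\<^sup>2 / 2) * exp (x\<^sup>2 / 4) = exp (- x\<^sup>2 / 4)"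
      by (metis exp_add)
    then show ?thesis
      by (simp add: normal_density_def real_sqrt_mult field_simps)
  qed
  then have "(\<integral>\<^sup>+x. ennreal (exp (x\<^sup>2 / 4)) \<partial>(std_gaussian :: real measure))
     = (\<integral>\<^sup>+x. ennreal (sqrt 2) * ennreal (normal_density 0 (sqrt 2) x) \<partial>lborel)"
    by (subst nn_integral_std_gaussian) (auto simp: ennreal_mult''[symmetric])
  also have "\<dots> = ennreal (sqrt 2)"
    by (subst nn_integral_cmult) (auto simp: nn_integral_std_normal_density)
  finally show ?thesis .
qed

text \<open>An independent \<open>\<lambda> \<sim> N(0, 1)\<close> linearizes the square, \<open>exp (x\<^sup>2 / 4) = E exp (\<lambda> x / \<surd>2)\<close>,
  so no one-dimensional marginals of the Gaussian measure are needed.\<close>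

lemma std_gaussian_exp_square_bound:
  fixes e :: "'h::euclidean_space"
  assumes "norm e \<le> 1"
  shows "(\<integral>\<^sup>+z. ennreal (exp ((z \<bullet> e)\<^sup>2 / 4)) \<partial>std_gaussian) \<le> ennreal (sqrt 2)"
proof -
  interpret G: prob_space "std_gaussian :: 'h measure" by (rule prob_space_std_gaussian)
  interpret R: prob_space "std_gaussian :: real measure" by (rule prob_space_std_gaussian)
  interpret P: pair_sigma_finite "std_gaussian :: 'h measure" "std_gaussian :: real measure" ..
  have lin: "ennreal (exp (y\<^sup>2 / 4)) = (\<integral>\<^sup>+l. ennreal (exp (l * (y / sqrt 2))) \<partial>std_gaussian)" for y :: real
    using std_gaussian_mgf[of "y / sqrt 2"] by (simp add: power_divide)
  have "(\<integral>\<^sup>+z. ennreal (exp ((z \<bullet> e)\<^sup>2 / 4)) \<partial>std_gaussian)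
      = (\<integral>\<^sup>+z. \<integral>\<^sup>+l. ennreal (exp (l * ((z \<bullet> e) / sqrt 2))) \<partial>std_gaussian \<partial>std_gaussian)"
    by (simp only: lin)
  also have "\<dots> = (\<integral>\<^sup>+l. \<integral>\<^sup>+z. ennreal (exp (l * ((z \<bullet> e) / sqrt 2))) \<partial>std_gaussian \<partial>std_gaussian)"
    by (rule P.Fubini'[symmetric]) measurable
  \<comment> \<open>For fixed \<open>l\<close> the inner integral over \<open>z\<close> is the
    moment generating function at \<open>(l / sqrt 2) *\<^sub>R e\<close>.\<close>
  also have "\<dots> = (\<integral>\<^sup>+l. ennreal (exp ((norm ((l / sqrt 2) *\<^sub>R e))\<^sup>2 / 2)) \<partial>std_gaussian)"
    by (simp only: std_gaussian_mgf[symmetric]) simp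
  also have "\<dots> \<le> (\<integral>\<^sup>+l. ennreal (exp (l\<^sup>2 / 4)) \<partial>(std_gaussian :: real measure))"
  proof (rule nn_integral_mono)
    fix l :: real
    have "(norm ((l / sqrt 2) *\<^sub>R e))\<^sup>2 \<le> l\<^sup>2 / 2"
      using mult_left_mono[OF power_le_one[OF norm_ge_zero assms, of 2], of "l\<^sup>2 / 2"]
      by (simp add: power_mult_distrib power_divide)
    then show "ennreal (exp ((norm ((l / sqrt 2) *\<^sub>R e))\<^sup>2 / 2)) \<le> ennreal (exp (l\<^sup>2 / 4))"
      by simp
  qed
  finally show ?thesis
    by (simp add: nn_integral_exp_quarter_square)
qed

section \<open>Jensen's inequality and dyadic sums\<close>

text \<open>Jensen is applied twice under the normalized weights \<open>a i / sum a I\<close>, first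
  to the square and then to exp; taking logarithms turns the exponent 1/4 into the factor 2. In the
  chaining, \<open>r\<close> is the absolute value of a normalized increment and \<open>D\<close>
  bounds the distance that scales it.\<close>

lemma exp_square_jensen:
  fixes a g r :: "'i \<Rightarrow> real"
  assumes fin: "finite I" and a: "\<And>i. i \<in> I \<Longrightarrow> 0 \<le> a i" and m: "0 < sum a I" and D: "0 \<le> D"
    and r: "\<And>i. i \<in> I \<Longrightarrow> 0 \<le> r i" and g: "\<And>i. i \<in> I \<Longrightarrow> \<bar>g i\<bar> \<le> D * r i"
    and K: "(\<Sum>i\<in>I. a i * exp ((r i)\<^sup>2 / 4)) \<le> K"
  shows "\<bar>\<Sum>i\<in>I. a i * g i\<bar> / sum a I \<le> 2 * D * sqrt (ln (K / sum a I))"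
proof -
  define b where "b i = a i / sum a I" for i
  have b: "0 \<le> b i" if "i \<in> I" for i
    using a[OF that] m by (simp add: b_def)
  have b1: "sum b I = 1"
    using m by (simp add: b_def sum_divide_distrib[symmetric])
  have I: "I \<noteq> {}" using m by auto
  define \<rho> where "\<rho> = (\<Sum>i\<in>I. b i * r i)"
  have "\<rho>\<^sup>2 \<le> (\<Sum>i\<in>I. b i * (r i)\<^sup>2)"
    using convex_on_sum[OF fin I convex_power2 b1, of r] b by (simp add: \<rho>_def)
  then have "exp (\<rho>\<^sup>2 / 4) \<le> exp (\<Sum>i\<in>I. b i * ((r i)\<^sup>2 / 4))"
    by (simp add: sum_divide_distrib[symmetric])
  also have "\<dots> \<le> (\<Sum>i\<in>I. b i * exp ((r i)\<^sup>2 / 4))"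
    using convex_on_sum[OF fin I exp_convex b1, of "\<lambda>i. (r i)\<^sup>2 / 4"] b by simp
  also have "\<dots> = (\<Sum>i\<in>I. a i * exp ((r i)\<^sup>2 / 4)) / sum a I"
    by (simp add: b_def sum_divide_distrib)
  also have "\<dots> \<le> K / sum a I"
    using K m by (simp add: divide_right_mono)
  finally have e: "exp (\<rho>\<^sup>2 / 4) \<le> K / sum a I" .
  then have "\<rho>\<^sup>2 / 4 \<le> ln (K / sum a I)"
    by (metis exp_gt_zero ln_exp ln_mono)
  then have "sqrt (\<rho>\<^sup>2) \<le> sqrt (4 * ln (K / sum a I))"
    by (intro real_sqrt_le_mono) simp
  then have \<rho>: "\<rho> \<le> 2 * sqrt (ln (K / sum a I))"
    by (simp add: real_sqrt_mult)
  have "\<bar>\<Sum>i\<in>I. a i * g i\<bar> \<le> (\<Sum>i\<in>I. a i * (D * r i))"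
    by (rule order_trans[OF sum_abs sum_mono]) (simp add: abs_mult a g mult_left_mono)
  then have "\<bar>\<Sum>i\<in>I. a i * g i\<bar> / sum a I \<le> (\<Sum>i\<in>I. a i * (D * r i)) / sum a I"
    using m by (simp add: divide_right_mono)
  also have "\<dots> = D * \<rho>"
    by (simp add: \<rho>_def b_def sum_distrib_left sum_divide_distrib mult_ac)
  also have "\<dots> \<le> 2 * D * sqrt (ln (K / sum a I))"
    using mult_left_mono[OF \<rho> D] by (simp add: mult_ac)
  finally show ?thesis .
qed

text \<open>The interval from \<open>\<sigma> / 2 ^ Suc n\<close> to \<open>\<sigma> / 2 ^ n\<close>
  has length \<open>\<sigma> / 2 ^ Suc n\<close>, and on it \<open>f\<close> is at least its value
  at the right end; these intervals are disjoint.\<close>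

lemma sum_dyadic_le_nn_integral:
  fixes f :: "real \<Rightarrow> ennreal"
  assumes anti: "\<And>x y. 0 < x \<Longrightarrow> x \<le> y \<Longrightarrow> f y \<le> f x" and \<sigma>: "0 < \<sigma>"
  shows "(\<Sum>n<N. ennreal (\<sigma> / 2 ^ Suc n) * f (\<sigma> / 2 ^ n)) \<le> (\<integral>\<^sup>+\<epsilon>\<in>{0..\<sigma>}. f \<epsilon> \<partial>lborel)"
proof -
  define I where "I n = {\<sigma> / 2 ^ Suc n<..\<sigma> / 2 ^ n}" for n
  have "(\<Sum>n<N. ennreal (\<sigma> / 2 ^ Suc n) * f (\<sigma> / 2 ^ n))
      = (\<Sum>n<N. \<integral>\<^sup>+\<epsilon>. f (\<sigma> / 2 ^ n) * indicator (I n) \<epsilon> \<partial>lborel)"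
  proof (rule sum.cong)
    fix n
    have "emeasure lborel (I n) = ennreal (\<sigma> / 2 ^ n - \<sigma> / 2 ^ Suc n)"
      unfolding I_def using \<sigma> by (intro emeasure_lborel_Ioc divide_left_mono power_increasing) auto
    also have "\<sigma> / 2 ^ n - \<sigma> / 2 ^ Suc n = \<sigma> / 2 ^ Suc n" by simp
    finally show "ennreal (\<sigma> / 2 ^ Suc n) * f (\<sigma> / 2 ^ n)
        = (\<integral>\<^sup>+\<epsilon>. f (\<sigma> / 2 ^ n) * indicator (I n) \<epsilon> \<partial>lborel)"
      by (subst nn_integral_cmult_indicator) (simp_all add: I_def mult.commute del: power_Suc)
  qed simp
  also have "\<dots> = (\<integral>\<^sup>+\<epsilon>. (\<Sum>n<N. f (\<sigma> / 2 ^ n) * indicator (I n) \<epsilon>) \<partial>lborel)"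
    by (rule nn_integral_sum[symmetric]) (auto simp: I_def)
  also have "\<dots> \<le> (\<integral>\<^sup>+\<epsilon>\<in>{0..\<sigma>}. f \<epsilon> \<partial>lborel)"
  proof (rule nn_integral_mono)
    fix \<epsilon> :: real
    show "(\<Sum>n<N. f (\<sigma> / 2 ^ n) * indicator (I n) \<epsilon>) \<le> f \<epsilon> * indicator {0..\<sigma>} \<epsilon>"
    proof (cases "\<exists>n<N. \<epsilon> \<in> I n")
      case True
      then obtain n where n: "n < N" "\<epsilon> \<in> I n" by auto
      have "\<epsilon> \<notin> I k" if "k \<noteq> n" for k
      proof -
        \<comment> \<open>The upper end of the interval with the larger index is at most the lower
          end of the other.\<close>
        have *: "\<sigma> / 2 ^ b \<le> \<sigma> / 2 ^ Suc a" if "a < b" for a b :: nat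
          using that \<sigma> by (intro divide_left_mono power_increasing) auto
        show ?thesis
          using *[of k n] *[of n k] n(2) that by (cases k n rule: linorder_cases) (auto simp: I_def)
      qed
      then have "(\<Sum>n<N. f (\<sigma> / 2 ^ n) * indicator (I n) \<epsilon>) = (\<Sum>k<N. if k = n then f (\<sigma> / 2 ^ n) else 0)"
        using n(2) by (intro sum.cong) auto
      also have "\<dots> = f (\<sigma> / 2 ^ n)"
        using n(1) by simp
      also have "\<dots> \<le> f \<epsilon> * indicator {0..\<sigma>} \<epsilon>"
      proof -
        have "0 < \<sigma> / 2 ^ Suc n" using \<sigma> by simp
        then have "0 < \<epsilon>" using n(2) unfolding I_def by (auto simp del: power_Suc)
        moreover have "\<epsilon> \<le> \<sigma> / 2 ^ n" using n(2) by (auto simp: I_def)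
        moreover have "\<sigma> / 2 ^ n \<le> \<sigma>" using \<sigma> by (simp add: divide_le_eq)
        ultimately show ?thesis using anti[of \<epsilon> "\<sigma> / 2 ^ n"] by auto
      qed
      finally show ?thesis .
    next
      case False
      then have "(\<Sum>n<N. f (\<sigma> / 2 ^ n) * indicator (I n) \<epsilon>) = 0" by auto
      then show ?thesis by simp
    qed
  qed
  finally show ?thesis .
qed

section \<open>Ball entropies at dyadic radii\<close>

lemma dball_mono: "x \<le> y \<Longrightarrow> dball v S t x \<subseteq> dball v S t y"
  by (auto simp: dball_def)

lemma sqrt_log_inv_antimono: "0 \<le> p \<Longrightarrow> p \<le> q \<Longrightarrow> sqrt_log_inv q \<le> sqrt_log_inv p"
  by (auto simp: sqrt_log_inv_def frac_le intro!: ennreal_leI)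

lemma sqrt_log_inv_dball_antimono:
  "x \<le> y \<Longrightarrow> sqrt_log_inv (measure_pmf.prob \<nu> (dball v S t y)) \<le> sqrt_log_inv (measure_pmf.prob \<nu> (dball v S t x))"
  by (intro sqrt_log_inv_antimono measure_pmf.finite_measure_mono dball_mono) auto

lemma sum_dyadic_le_pw_functional:
  assumes "0 < norm (v t)"
  shows "(\<Sum>n<N. ennreal (norm (v t) / 2 ^ Suc n) *
      sqrt_log_inv (measure_pmf.prob \<nu> (dball v S t (norm (v t) / 2 ^ n)))) \<le> pw_functional v S \<nu> t"
proof -
  have "(\<Sum>n<N. ennreal (norm (v t) / 2 ^ Suc n) *
      sqrt_log_inv (measure_pmf.prob \<nu> (dball v S t (norm (v t) / 2 ^ n))))
    \<le> (\<integral>\<^sup>+\<epsilon>\<in>{0..norm (v t)}. sqrt_log_inv (measure_pmf.prob \<nu> (dball v S t \<epsilon>)) \<partial>lborel)"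
    using assms by (intro sum_dyadic_le_nn_integral sqrt_log_inv_dball_antimono)
  also have "\<dots> \<le> pw_functional v S \<nu> t"
    unfolding pw_functional_def using assms
    by (intro nn_integral_mono mult_left_mono) (auto simp: indicator_def)
  finally show ?thesis .
qed

text \<open>A null ball would make one summand of the dyadic sum infinite, through the value of
  \<open>sqrt_log_inv\<close> at 0. Positivity makes the ball means of the chaining genuine
  averages.\<close>

lemma prob_dball_pos:
  assumes "pw_functional v S \<nu> t < \<infinity>" "0 < norm (v t)"
  shows "0 < measure_pmf.prob \<nu> (dball v S t (norm (v t) / 2 ^ n))"
proof (rule ccontr)
  assume "\<not> ?thesis"
  then have "sqrt_log_inv (measure_pmf.prob \<nu> (dball v S t (norm (v t) / 2 ^ n))) = \<infinity>"
    by (simp add: sqrt_log_inv_def zero_less_measure_iff)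
  then have "\<infinity> = ennreal (norm (v t) / 2 ^ Suc n) *
      sqrt_log_inv (measure_pmf.prob \<nu> (dball v S t (norm (v t) / 2 ^ n)))"
    using assms(2) by (simp add: ennreal_mult_top)
  also have "\<dots> \<le> (\<Sum>k<Suc n. ennreal (norm (v t) / 2 ^ Suc k) *
      sqrt_log_inv (measure_pmf.prob \<nu> (dball v S t (norm (v t) / 2 ^ k))))"
    by (rule member_le_sum) auto
  also have "\<dots> \<le> pw_functional v S \<nu> t"
    using assms(2) by (rule sum_dyadic_le_pw_functional)
  finally show False
    using assms(1) by simp
qed

text \<open>Real-valued form of \<open>sqrt_log_inv\<close> at the dyadic radii; the two agree on
  balls of positive mass, which \<open>prob_dball_pos\<close> supplies.\<close>

definition chain_entropy :: "('s \<Rightarrow> 'h::euclidean_space) \<Rightarrow> 's set \<Rightarrow> 's pmf \<Rightarrow> 's \<Rightarrow> nat \<Rightarrow> real" where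
  "chain_entropy v S \<nu> t n = sqrt (ln (1 / measure_pmf.prob \<nu> (dball v S t (norm (v t) / 2 ^ n))))"

lemma chain_entropy_nonneg: "0 \<le> chain_entropy v S \<nu> t n"
  by (cases "measure_pmf.prob \<nu> (dball v S t (norm (v t) / 2 ^ n)) = 0")
    (auto simp: chain_entropy_def zero_less_measure_iff)

text \<open>The factor 2 is the ratio between a dyadic radius and the length of its interval in the
  integral.\<close>

lemma sum_chain_entropy_le:
  assumes "pw_functional v S \<nu> t < \<infinity>" "0 < norm (v t)"
  shows "(\<Sum>n<N. norm (v t) / 2 ^ n * chain_entropy v S \<nu> t n) \<le> 2 * enn2real (pw_functional v S \<nu> t)"
proof -
  have "ennreal (\<Sum>n<N. norm (v t) / 2 ^ Suc n * chain_entropy v S \<nu> t n)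
      = (\<Sum>n<N. ennreal (norm (v t) / 2 ^ Suc n * chain_entropy v S \<nu> t n))"
    by (rule sum_ennreal[symmetric]) (simp add: chain_entropy_nonneg)
  also have "\<dots> = (\<Sum>n<N. ennreal (norm (v t) / 2 ^ Suc n) *
      sqrt_log_inv (measure_pmf.prob \<nu> (dball v S t (norm (v t) / 2 ^ n))))"
  proof (rule sum.cong)
    fix n
    have "sqrt_log_inv (measure_pmf.prob \<nu> (dball v S t (norm (v t) / 2 ^ n))) = ennreal (chain_entropy v S \<nu> t n)"
      using prob_dball_pos[OF assms, of n] by (simp add: sqrt_log_inv_def chain_entropy_def)
    then show "ennreal (norm (v t) / 2 ^ Suc n * chain_entropy v S \<nu> t n) = ennreal (norm (v t) / 2 ^ Suc n) *
        sqrt_log_inv (measure_pmf.prob \<nu> (dball v S t (norm (v t) / 2 ^ n)))"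
      by (simp only: ennreal_mult chain_entropy_nonneg divide_nonneg_nonneg norm_ge_zero zero_le_power zero_le_numeral)
  qed simp
  also have "\<dots> \<le> pw_functional v S \<nu> t"
    using assms(2) by (rule sum_dyadic_le_pw_functional)
  also have "\<dots> = ennreal (enn2real (pw_functional v S \<nu> t))"
    using assms(1) by simp
  finally have "(\<Sum>n<N. norm (v t) / 2 ^ Suc n * chain_entropy v S \<nu> t n) \<le> enn2real (pw_functional v S \<nu> t)"
    by (subst (asm) ennreal_le_iff) auto
  moreover have "(\<Sum>n<N. norm (v t) / 2 ^ n * chain_entropy v S \<nu> t n)
      = 2 * (\<Sum>n<N. norm (v t) / 2 ^ Suc n * chain_entropy v S \<nu> t n)"
    by (simp add: sum_distrib_left)
  ultimately show ?thesis by simp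
qed

section \<open>Chaining\<close>

text \<open>The random variable W of the introduction: the inner product with
  \<open>sgn (v x - v y)\<close> is the increment divided by the distance. Since
  \<open>sgn 0 = 0\<close>, diagonal pairs contribute just their weight.\<close>

definition increment_moment :: "('s \<Rightarrow> 'h::euclidean_space) \<Rightarrow> 's set \<Rightarrow> 's pmf \<Rightarrow> 'h \<Rightarrow> real" where
  "increment_moment v S \<nu> z =
     (\<Sum>(x, y)\<in>S \<times> S. pmf \<nu> x * pmf \<nu> y * exp ((z \<bullet> sgn (v x - v y))\<^sup>2 / 4)) +
     (\<Sum>x\<in>S. pmf \<nu> x * exp ((z \<bullet> sgn (v x))\<^sup>2 / 4))"

definition ball_mean :: "('s \<Rightarrow> 'h::euclidean_space) \<Rightarrow> 's pmf \<Rightarrow> 'h \<Rightarrow> 's set \<Rightarrow> real" where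
  "ball_mean v \<nu> z B = (\<Sum>x\<in>B. pmf \<nu> x * (z \<bullet> v x)) / measure_pmf.prob \<nu> B"

lemma abs_inner_eq_norm_mult_sgn: "\<bar>z \<bullet> u\<bar> = norm u * \<bar>z \<bullet> sgn u\<bar>" for u :: "'h::real_inner"
  by (cases "u = 0") (simp_all add: sgn_div_norm abs_mult)

text \<open>Starts the chain by comparing a ball mean with the value 0 at the origin. The origin may
  have no mass under \<open>\<nu>\<close>, so this uses the second sum of
  \<open>increment_moment\<close>.\<close>

lemma abs_ball_mean_le:
  assumes fin: "finite S" and B: "B \<subseteq> S" and pos: "0 < measure_pmf.prob \<nu> B"
    and D: "0 \<le> D" "\<And>x. x \<in> B \<Longrightarrow> norm (v x) \<le> D" and K: "increment_moment v S \<nu> z \<le> K"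
  shows "\<bar>ball_mean v \<nu> z B\<bar> \<le> 2 * D * sqrt (ln (K / measure_pmf.prob \<nu> B))"
proof -
  have fB: "finite B" using fin B by (rule finite_subset[rotated])
  note p = measure_measure_pmf_finite[OF fB, of \<nu>]
  have "(\<Sum>x\<in>B. pmf \<nu> x * exp (\<bar>z \<bullet> sgn (v x)\<bar>\<^sup>2 / 4)) \<le> (\<Sum>x\<in>S. pmf \<nu> x * exp ((z \<bullet> sgn (v x))\<^sup>2 / 4))"
    unfolding power2_abs by (intro sum_mono2 fin B) simp
  also have "\<dots> \<le> increment_moment v S \<nu> z"
    by (simp add: increment_moment_def sum_nonneg split_beta)
  finally have "\<bar>\<Sum>x\<in>B. pmf \<nu> x * (z \<bullet> v x)\<bar> / sum (pmf \<nu>) B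
      \<le> 2 * D * sqrt (ln (K / sum (pmf \<nu>) B))"
    using pos K D
    by (intro exp_square_jensen[OF fB, where r = "\<lambda>x. \<bar>z \<bullet> sgn (v x)\<bar>"])
      (auto simp: p abs_inner_eq_norm_mult_sgn[of z "v _"] mult_right_mono)
  then show ?thesis
    using pos by (simp add: ball_mean_def p)
qed

text \<open>The difference of the two means is the average of the increments over pairs under the
  product weights. Jensen is therefore applied on \<open>B \<times> B'\<close>, whose total mass is
  the product of the two masses.\<close>

lemma abs_ball_mean_diff_le:
  assumes fin: "finite S" and B: "B \<subseteq> S" "B' \<subseteq> S"
    and pos: "0 < measure_pmf.prob \<nu> B" "0 < measure_pmf.prob \<nu> B'"
    and D: "0 \<le> D" "\<And>x y. x \<in> B \<Longrightarrow> y \<in> B' \<Longrightarrow> dist (v x) (v y) \<le> D"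
    and K: "increment_moment v S \<nu> z \<le> K"
  shows "\<bar>ball_mean v \<nu> z B - ball_mean v \<nu> z B'\<bar>
    \<le> 2 * D * sqrt (ln (K / (measure_pmf.prob \<nu> B * measure_pmf.prob \<nu> B')))"
proof -
  have fB: "finite B" "finite B'" using fin B by (auto intro: finite_subset)
  note p = measure_measure_pmf_finite[OF fB(1), of \<nu>] measure_measure_pmf_finite[OF fB(2), of \<nu>]
  define a where "a = (\<lambda>(x, y). pmf \<nu> x * pmf \<nu> y)"
  have a_nonneg: "0 \<le> a i" for i
    by (simp add: a_def split_beta)
  have sum_a: "sum a (B \<times> B') = sum (pmf \<nu>) B * sum (pmf \<nu>) B'"
    unfolding a_def by (simp add: sum_product sum.cartesian_product)
  have "(\<Sum>i\<in>B \<times> B'. a i * exp (\<bar>z \<bullet> sgn (v (fst i) - v (snd i))\<bar>\<^sup>2 / 4))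
     \<le> (\<Sum>i\<in>S \<times> S. a i * exp (\<bar>z \<bullet> sgn (v (fst i) - v (snd i))\<bar>\<^sup>2 / 4))"
    using fin B by (intro sum_mono2) (auto simp: a_nonneg)
  also have "\<dots> \<le> increment_moment v S \<nu> z"
    unfolding power2_abs by (simp add: increment_moment_def a_def sum_nonneg split_beta)
  finally have "\<bar>\<Sum>i\<in>B \<times> B'. a i * (z \<bullet> (v (fst i) - v (snd i)))\<bar> / sum a (B \<times> B')
      \<le> 2 * D * sqrt (ln (K / sum a (B \<times> B')))"
    using pos K D fB
    by (intro exp_square_jensen[where r = "\<lambda>i. \<bar>z \<bullet> sgn (v (fst i) - v (snd i))\<bar>"])
      (auto simp: p sum_a abs_inner_eq_norm_mult_sgn[of z "_ - _"] dist_norm a_nonneg intro!: mult_right_mono)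
  \<comment> \<open>Summing out the other coordinate leaves each term multiplied by the mass of the
    other ball; division by the product of the masses then gives the two means.\<close>
  also have "(\<Sum>i\<in>B \<times> B'. a i * (z \<bullet> (v (fst i) - v (snd i))))
      = (\<Sum>x\<in>B. pmf \<nu> x * (z \<bullet> v x)) * sum (pmf \<nu>) B' - sum (pmf \<nu>) B * (\<Sum>y\<in>B'. pmf \<nu> y * (z \<bullet> v y))"
    unfolding sum_product sum.cartesian_product sum_subtractf[symmetric]
    by (rule sum.cong) (auto simp: a_def algebra_simps)
  also have "\<bar>\<dots>\<bar> / sum a (B \<times> B') = \<bar>\<dots> / sum a (B \<times> B')\<bar>"
    using pos by (simp add: p sum_a)
  also have "((\<Sum>x\<in>B. pmf \<nu> x * (z \<bullet> v x)) * sum (pmf \<nu>) B' - sum (pmf \<nu>) B * (\<Sum>y\<in>B'. pmf \<nu> y * (z \<bullet> v y)))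
      / sum a (B \<times> B') = ball_mean v \<nu> z B - ball_mean v \<nu> z B'"
    using pos by (simp add: ball_mean_def p sum_a diff_divide_distrib)
  finally show ?thesis
    by (simp only: p sum_a)
qed

text \<open>A crude Cauchy-Schwarz bound depending on \<open>norm z\<close>. It closes the chain:
  for fixed \<open>z\<close> it vanishes as the radius tends to 0.\<close>

lemma abs_ball_mean_minus_center_le:
  assumes fin: "finite B" and pos: "0 < measure_pmf.prob \<nu> B"
    and D: "\<And>x. x \<in> B \<Longrightarrow> dist (v x) (v t) \<le> D"
  shows "\<bar>ball_mean v \<nu> z B - z \<bullet> v t\<bar> \<le> D * norm z"
proof -
  note p = measure_measure_pmf_finite[OF fin, of \<nu>]
  have "(\<Sum>x\<in>B. pmf \<nu> x * (z \<bullet> (v x - v t))) = (\<Sum>x\<in>B. pmf \<nu> x * (z \<bullet> v x)) - sum (pmf \<nu>) B * (z \<bullet> v t)"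
    by (simp add: inner_diff_right right_diff_distrib sum_subtractf sum_distrib_right)
  then have "ball_mean v \<nu> z B - z \<bullet> v t = (\<Sum>x\<in>B. pmf \<nu> x * (z \<bullet> (v x - v t))) / sum (pmf \<nu>) B"
    using pos by (simp add: ball_mean_def p field_simps)
  moreover have "\<bar>\<Sum>x\<in>B. pmf \<nu> x * (z \<bullet> (v x - v t))\<bar> \<le> (\<Sum>x\<in>B. pmf \<nu> x * (D * norm z))"
  proof (rule order_trans[OF sum_abs sum_mono])
    fix x assume "x \<in> B"
    have "\<bar>z \<bullet> (v x - v t)\<bar> \<le> norm z * norm (v x - v t)"
      by (rule Cauchy_Schwarz_ineq2)
    also have "\<dots> \<le> D * norm z"
      using D[OF \<open>x \<in> B\<close>] by (simp add: dist_norm mult.commute[of D] mult_left_mono)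
    finally show "\<bar>pmf \<nu> x * (z \<bullet> (v x - v t))\<bar> \<le> pmf \<nu> x * (D * norm z)"
      by (simp add: abs_mult mult_left_mono)
  qed
  ultimately show ?thesis
    using pos by (simp add: p pos_divide_le_eq sum_distrib_right[symmetric] mult.commute)
qed

lemma chaining_bound:
  fixes v :: "'s \<Rightarrow> 'h::euclidean_space"
  assumes fin: "finite S" and fn: "pw_functional v S \<nu> t < \<infinity>" and nz: "0 < norm (v t)"
    and K: "increment_moment v S \<nu> z \<le> K" "1 \<le> K"
  shows "\<bar>z \<bullet> v t\<bar> \<le> 26 * enn2real (pw_functional v S \<nu> t) + 10 * norm (v t) * sqrt (ln K)"
proof -
  define e where "e n = norm (v t) / 2 ^ n" for n :: nat
  define B where "B n = dball v S t (e n)" for n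
  define L where "L n = chain_entropy v S \<nu> t n" for n
  define m where "m n = ball_mean v \<nu> z (B n)" for n
  define l where "l = sqrt (ln K)"
  define \<Phi> where "\<Phi> = enn2real (pw_functional v S \<nu> t)"
  have e: "0 < e n" "e (Suc n) = e n / 2" for n
    using nz by (simp_all add: e_def)
  have BS: "B n \<subseteq> S" for n
    by (auto simp: B_def dball_def)
  have pos: "0 < measure_pmf.prob \<nu> (B n)" for n
    using prob_dball_pos[OF fn nz] by (simp add: B_def e_def)
  have ln_inv: "0 \<le> ln (1 / measure_pmf.prob \<nu> (B n))" for n
    using pos[of n] by (intro ln_ge_zero) simp
  have L: "sqrt (ln (1 / measure_pmf.prob \<nu> (B n))) = L n" "0 \<le> L n" for n
    by (simp add: L_def chain_entropy_def B_def e_def) (simp add: L_def chain_entropy_nonneg)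
  have l: "0 \<le> l" "0 \<le> ln K"
    using K(2) by (simp_all add: l_def)
  have near: "dist (v x) (v t) \<le> e n" if "x \<in> B n" for x n
    using that by (simp add: B_def dball_def)
  have lim_e: "e \<longlonglongrightarrow> 0"
    unfolding e_def[abs_def] by real_asymp
  \<comment> \<open>Points of the first ball have norm at most
    \<open>norm (v t) + e 0 = 2 * e 0\<close>, and Jensen doubles this to 4.\<close>
  have first: "\<bar>m 0\<bar> \<le> 4 * e 0 * (L 0 + l)"
  proof -
    have "norm (v x) \<le> 2 * e 0" if "x \<in> B 0" for x
      using norm_triangle_sub[of "v x" "v t"] near[OF that] by (simp add: e_def dist_norm)
    then have "\<bar>m 0\<bar> \<le> 2 * (2 * e 0) * sqrt (ln (K / measure_pmf.prob \<nu> (B 0)))"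
      unfolding m_def using e(1)[of 0] by (intro abs_ball_mean_le[OF fin BS pos] K(1)) auto
    also have "ln (K / measure_pmf.prob \<nu> (B 0)) = ln (1 / measure_pmf.prob \<nu> (B 0)) + ln K"
      using pos[of 0] K(2) by (simp add: ln_div)
    also have "sqrt \<dots> \<le> L 0 + l"
      using sqrt_add_le_add_sqrt[OF ln_inv[of 0] l(2)] by (simp only: L l_def)
    finally show ?thesis
      using e(1)[of 0] by (simp add: mult_left_mono)
  qed
  \<comment> \<open>Through the common center, points of consecutive balls are within
    \<open>e n + e n / 2\<close>; Jensen doubles 3/2 to 3.\<close>
  have step: "\<bar>m n - m (Suc n)\<bar> \<le> 3 * e n * (L n + L (Suc n) + l)" for n
  proof -
    have "dist (v x) (v y) \<le> 3 / 2 * e n" if "x \<in> B n" "y \<in> B (Suc n)" for x y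
      using dist_triangle2[of "v x" "v y" "v t"] near[OF that(1)] near[OF that(2)] by (simp add: e(2))
    then have "\<bar>m n - m (Suc n)\<bar>
        \<le> 2 * (3 / 2 * e n) * sqrt (ln (K / (measure_pmf.prob \<nu> (B n) * measure_pmf.prob \<nu> (B (Suc n)))))"
      unfolding m_def using e(1)[of n] by (intro abs_ball_mean_diff_le[OF fin BS BS pos pos] K(1)) auto
    also have "ln (K / (measure_pmf.prob \<nu> (B n) * measure_pmf.prob \<nu> (B (Suc n))))
        = (ln (1 / measure_pmf.prob \<nu> (B n)) + ln (1 / measure_pmf.prob \<nu> (B (Suc n)))) + ln K"
      using pos[of n] pos[of "Suc n"] K(2) by (simp add: ln_div ln_mult)
    also have "sqrt \<dots> \<le> L n + L (Suc n) + l"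
      using sqrt_add_le_add_sqrt[OF add_nonneg_nonneg[OF ln_inv[of n] ln_inv[of "Suc n"]] l(2)]
        sqrt_add_le_add_sqrt[OF ln_inv[of n] ln_inv[of "Suc n"]]
      unfolding L l_def by linarith
    finally show ?thesis
      using e(1)[of n] by (simp add: mult_left_mono)
  qed
  have sum_eL: "(\<Sum>n<N. e n * L n) \<le> 2 * \<Phi>" for N
    using sum_chain_entropy_le[OF fn nz, of N] by (simp add: e_def L_def \<Phi>_def)
  \<comment> \<open>Shifting the index of the radius to match the entropy costs another factor
    2.\<close>
  have sum_eL': "(\<Sum>n<N. e n * L (Suc n)) \<le> 4 * \<Phi>" for N
  proof -
    have "(\<Sum>n<N. e n * L (Suc n)) = 2 * (\<Sum>n<N. e (Suc n) * L (Suc n))"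
      by (simp add: sum_distrib_left e(2))
    also have "(\<Sum>n<N. e (Suc n) * L (Suc n)) \<le> (\<Sum>n<Suc N. e n * L n)"
      using e(1)[of 0] L(2)[of 0] by (simp add: sum.lessThan_Suc_shift del: sum.lessThan_Suc)
    also have "\<dots> \<le> 2 * \<Phi>"
      by (rule sum_eL)
    finally show ?thesis by simp
  qed
  have sum_e: "(\<Sum>n<N. e n) \<le> 2 * e 0" for N
  proof -
    have "(\<Sum>n<N. e n) = 2 * e 0 - 2 * e N"
      by (induction N) (simp_all add: e(2))
    then show ?thesis using e(1)[of N] by simp
  qed
  \<comment> \<open>The links contribute \<open>3 * 2 + 3 * 4 = 18\<close> and the first ball
    \<open>4 * 2 = 8\<close> to the coefficient of \<open>\<Phi>\<close>, and 6 and 4 to that of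
    \<open>e 0 * l\<close>.\<close>
  have bound: "\<bar>z \<bullet> v t\<bar> \<le> e N * norm z + (26 * \<Phi> + 10 * e 0 * l)" for N
  proof -
    have "m 0 - m N = (\<Sum>n<N. m n - m (Suc n))"
      by (rule sum_lessThan_telescope'[symmetric])
    then have "\<bar>m 0 - m N\<bar> \<le> (\<Sum>n<N. 3 * e n * (L n + L (Suc n) + l))"
      by (simp add: order_trans[OF sum_abs sum_mono[OF step]])
    also have "\<dots> = 3 * (\<Sum>n<N. e n * L n) + 3 * (\<Sum>n<N. e n * L (Suc n)) + 3 * l * (\<Sum>n<N. e n)"
      by (simp add: sum_distrib_left sum.distrib algebra_simps)
    also have "\<dots> \<le> 3 * (2 * \<Phi>) + 3 * (4 * \<Phi>) + 3 * l * (2 * e 0)"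
      using sum_eL[of N] sum_eL'[of N] sum_e[of N] l(1) by (intro add_mono mult_left_mono) auto
    finally have "\<bar>m 0 - m N\<bar> \<le> 18 * \<Phi> + 6 * e 0 * l"
      by (simp add: mult.commute)
    moreover have "\<bar>m 0\<bar> \<le> 8 * \<Phi> + 4 * e 0 * l"
      using first sum_eL[of 1] by (simp add: algebra_simps)
    moreover have "\<bar>m N - z \<bullet> v t\<bar> \<le> e N * norm z"
      unfolding m_def
      by (rule abs_ball_mean_minus_center_le) (use finite_subset[OF BS fin] pos near in auto)
    ultimately show ?thesis
      by linarith
  qed
  \<comment> \<open>Letting \<open>N\<close> grow removes the term with \<open>norm z\<close>, the
    only one not controlled by \<open>K\<close>.\<close>
  have "(\<lambda>N. e N * norm z + (26 * \<Phi> + 10 * e 0 * l)) \<longlonglongrightarrow> 0 * norm z + (26 * \<Phi> + 10 * e 0 * l)"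
    by (intro tendsto_intros lim_e)
  then have "\<bar>z \<bullet> v t\<bar> \<le> 0 * norm z + (26 * \<Phi> + 10 * e 0 * l)"
    using bound by (intro LIMSEQ_le_const) auto
  then show ?thesis
    by (simp add: \<Phi>_def e_def l_def)
qed

section \<open>Mean and tail of the increment moment\<close>

lemma increment_moment_measurable [measurable]: "increment_moment v S \<nu> \<in> borel_measurable borel"
  unfolding increment_moment_def[abs_def] split_beta by measurable

text \<open>Every direction has norm at most 1, so every exponential has mean at most sqrt 2. The
  weights of each of the two sums total at most 1.\<close>

lemma nn_integral_increment_moment_le:
  fixes v :: "'s \<Rightarrow> 'h::euclidean_space"
  assumes fin: "finite S"
  shows "(\<integral>\<^sup>+z. ennreal (increment_moment v S \<nu> z) \<partial>std_gaussian) \<le> ennreal (2 * sqrt 2)"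
proof -
  have aux: "(\<integral>\<^sup>+z. ennreal (\<Sum>i\<in>I. a i * exp ((z \<bullet> sgn (u i))\<^sup>2 / 4)) \<partial>std_gaussian) \<le> ennreal (sqrt 2)"
    if "\<And>i. i \<in> I \<Longrightarrow> 0 \<le> a i" "sum a I \<le> 1" for I :: "'i set" and a and u :: "'i \<Rightarrow> 'h"
  proof -
    have "(\<integral>\<^sup>+z. ennreal (\<Sum>i\<in>I. a i * exp ((z \<bullet> sgn (u i))\<^sup>2 / 4)) \<partial>std_gaussian)
        = (\<integral>\<^sup>+z. (\<Sum>i\<in>I. ennreal (a i) * ennreal (exp ((z \<bullet> sgn (u i))\<^sup>2 / 4))) \<partial>std_gaussian)"
      using that(1) by (simp add: sum_ennreal[symmetric] ennreal_mult)
    also have "\<dots> = (\<Sum>i\<in>I. ennreal (a i) * (\<integral>\<^sup>+z. ennreal (exp ((z \<bullet> sgn (u i))\<^sup>2 / 4)) \<partial>std_gaussian))"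
      by (simp add: nn_integral_sum nn_integral_cmult)
    also have "\<dots> \<le> (\<Sum>i\<in>I. ennreal (a i) * ennreal (sqrt 2))"
      by (intro sum_mono mult_left_mono std_gaussian_exp_square_bound) (auto simp: norm_sgn)
    also have "\<dots> = ennreal (sum a I * sqrt 2)"
      using that(1) by (simp add: sum_distrib_right[symmetric] ennreal_mult sum_nonneg)
    also have "\<dots> \<le> ennreal (sqrt 2)"
      using that(2) by (intro ennreal_leI) (simp add: mult_left_le_one_le mult.commute)
    finally show ?thesis .
  qed
  have p: "sum (pmf \<nu>) S \<le> 1"
    using measure_pmf.prob_le_1[of \<nu> S] by (simp add: measure_measure_pmf_finite[OF fin])
  have pp: "(\<Sum>i\<in>S \<times> S. pmf \<nu> (fst i) * pmf \<nu> (snd i)) = sum (pmf \<nu>) S * sum (pmf \<nu>) S"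
    by (simp add: sum_product sum.cartesian_product split_beta)
  have "(\<integral>\<^sup>+z. ennreal (increment_moment v S \<nu> z) \<partial>std_gaussian)
      = (\<integral>\<^sup>+z. ennreal (\<Sum>i\<in>S \<times> S. pmf \<nu> (fst i) * pmf \<nu> (snd i) * exp ((z \<bullet> sgn (v (fst i) - v (snd i)))\<^sup>2 / 4)) +
         ennreal (\<Sum>x\<in>S. pmf \<nu> x * exp ((z \<bullet> sgn (v x))\<^sup>2 / 4)) \<partial>std_gaussian)"
    by (simp add: increment_moment_def split_beta sum_nonneg)
  also have "\<dots> = (\<integral>\<^sup>+z. ennreal (\<Sum>i\<in>S \<times> S. pmf \<nu> (fst i) * pmf \<nu> (snd i) * exp ((z \<bullet> sgn (v (fst i) - v (snd i)))\<^sup>2 / 4)) \<partial>std_gaussian)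
     + (\<integral>\<^sup>+z. ennreal (\<Sum>x\<in>S. pmf \<nu> x * exp ((z \<bullet> sgn (v x))\<^sup>2 / 4)) \<partial>std_gaussian)"
    by (rule nn_integral_add) measurable
  also have "\<dots> \<le> ennreal (sqrt 2) + ennreal (sqrt 2)"
    using p by (intro add_mono aux) (auto simp: pp sum_nonneg mult_le_one)
  also have "\<dots> = ennreal (2 * sqrt 2)"
    by (simp flip: ennreal_plus)
  finally show ?thesis .
qed

lemma prob_increment_moment_le:
  assumes "finite S" and \<delta>: "0 < \<delta>"
  shows "1 - \<delta> \<le> \<P>(z in std_gaussian. increment_moment v S \<nu> z \<le> 2 * sqrt 2 / \<delta>)"
proof -
  interpret prob_space std_gaussian by (rule prob_space_std_gaussian)
  \<comment> \<open>Markov's inequality is used in the form \<open>P(1 <= c * W) <= c * E W\<close>,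
    and the mean bound makes the right-hand side at most \<delta>.\<close>
  define c where "c = \<delta> / (2 * sqrt 2)"
  have c: "0 < c" "c * (2 * sqrt 2) = \<delta>" using \<delta> by (simp_all add: c_def)
  have "emeasure std_gaussian {z \<in> space std_gaussian. \<not> increment_moment v S \<nu> z \<le> 2 * sqrt 2 / \<delta>}
      \<le> emeasure std_gaussian {z \<in> UNIV. 1 \<le> ennreal c * ennreal (increment_moment v S \<nu> z)}"
  proof (rule emeasure_mono)
    show "{z \<in> space std_gaussian. \<not> increment_moment v S \<nu> z \<le> 2 * sqrt 2 / \<delta>}
        \<subseteq> {z \<in> UNIV. 1 \<le> ennreal c * ennreal (increment_moment v S \<nu> z)}"
    proof safe
      fix z assume "\<not> increment_moment v S \<nu> z \<le> 2 * sqrt 2 / \<delta>"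
      then have "1 \<le> c * increment_moment v S \<nu> z"
        using \<delta> by (simp add: c_def field_simps)
      then show "1 \<le> ennreal c * ennreal (increment_moment v S \<nu> z)"
        using c(1) by (simp add: ennreal_mult'[symmetric] flip: ennreal_1)
    qed simp
  qed measurable
  also have "\<dots> \<le> ennreal c * (\<integral>\<^sup>+z. ennreal (increment_moment v S \<nu> z) * indicator UNIV z \<partial>std_gaussian)"
    by (rule nn_integral_Markov_inequality) auto
  also have "\<dots> \<le> ennreal c * ennreal (2 * sqrt 2)"
    using nn_integral_increment_moment_le[OF assms(1), of v \<nu>] by (intro mult_left_mono) auto
  also have "\<dots> = ennreal \<delta>"
    using c by (simp add: ennreal_mult'[symmetric])
  finally have "\<P>(z in std_gaussian. \<not> increment_moment v S \<nu> z \<le> 2 * sqrt 2 / \<delta>) \<le> \<delta>"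
    using \<delta> by (simp add: emeasure_eq_measure)
  then show ?thesis
    by (subst (asm) prob_neg) auto
qed

section \<open>Comparison of the chaining bound with the stated envelope\<close>

lemma one_le_increment_threshold: "1 \<le> 2 * sqrt 2 / \<delta>" if "0 < \<delta>" "\<delta> < 1"
proof -
  have "1 \<le> sqrt 2" by simp
  then have "\<delta> \<le> 2 * sqrt 2" using that(2) by linarith
  then show ?thesis using that(1) by simp
qed

text \<open>The cutoffs \<open>r\<^sub>0\<close> and \<open>s\<^sub>0\<close> only enlarge the
  envelope, and \<open>sqrt 2 \<le> exp 1 * k\<close> compares the logarithms. The constant 26
  covers both 26 and 10.\<close>

lemma gaussian_envelope_ge:
  assumes C: "26 \<le> C" and r: "0 < r\<^sub>0" and s: "0 < s\<^sub>0" "s\<^sub>0 \<le> sup_radius v S"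
    and \<delta>: "0 < \<delta>" "\<delta> < 1"
  shows "26 * enn2real (pw_functional v S \<nu> t) + 10 * norm (v t) * sqrt (ln (2 * sqrt 2 / \<delta>))
    \<le> gaussian_envelope C v S \<nu> r\<^sub>0 s\<^sub>0 \<delta> t"
proof -
  define k where "k = real_of_int (num_levels v S \<nu> r\<^sub>0 s\<^sub>0)"
  \<comment> \<open>The second ceiling is nonnegative since
    \<open>s\<^sub>0 \<le> sup_radius v S\<close>, the first by its truncation at 0, so both factors
    are at least 1.\<close>
  have "1 \<le> num_levels v S \<nu> r\<^sub>0 s\<^sub>0"
  proof -
    have "0 \<le> log 2 (sup_radius v S / s\<^sub>0)"
      using s by simp
    then have "0 \<le> \<lceil>log 2 (sup_radius v S / s\<^sub>0)\<rceil>" by linarith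
    moreover have "0 \<le> \<lceil>max (log 2 (enn2real (sup_functional v S \<nu>) / r\<^sub>0)) 0\<rceil>" by linarith
    ultimately have "1 * 1 \<le> num_levels v S \<nu> r\<^sub>0 s\<^sub>0"
      unfolding num_levels_def by (intro mult_mono) auto
    then show ?thesis by simp
  qed
  then have k: "1 \<le> k" by (simp add: k_def)
  have "sqrt 2 \<le> 2" by (rule real_le_lsqrt) auto
  also have "2 \<le> exp (1::real)" using exp_ge_add_one_self[of 1] by simp
  finally have "sqrt 2 * 1 \<le> exp 1 * k"
    using k by (intro mult_mono) auto
  then have "2 * sqrt 2 / \<delta> \<le> 2 * exp 1 * k / \<delta>"
    using \<delta> by (intro divide_right_mono) auto
  then have le: "sqrt (ln (2 * sqrt 2 / \<delta>)) \<le> sqrt (ln (2 * exp 1 * k / \<delta>))"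
    using \<delta> by (intro real_sqrt_le_mono ln_mono) auto
  have nn: "0 \<le> sqrt (ln (2 * sqrt 2 / \<delta>))"
    using one_le_increment_threshold[OF \<delta>] by simp
  have "26 * enn2real (pw_functional v S \<nu> t) + 10 * norm (v t) * sqrt (ln (2 * sqrt 2 / \<delta>))
      \<le> 26 * (enn2real (pw_functional v S \<nu> t) + norm (v t) * sqrt (ln (2 * sqrt 2 / \<delta>)))"
    using nn by (simp add: mult_right_mono)
  also have "\<dots> \<le> C * (max (enn2real (pw_functional v S \<nu> t)) r\<^sub>0 +
      max (norm (v t)) s\<^sub>0 * sqrt (ln (2 * exp 1 * k / \<delta>)))"
    using C nn le s(1) by (intro mult_mono add_mono) auto
  finally show ?thesis
    by (simp add: gaussian_envelope_def k_def)
qed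

lemma gaussian_envelope_nonneg:
  assumes "26 \<le> C" "0 < r\<^sub>0" "0 < s\<^sub>0" "s\<^sub>0 \<le> sup_radius v S" "0 < \<delta>" "\<delta> < 1"
  shows "0 \<le> gaussian_envelope C v S \<nu> r\<^sub>0 s\<^sub>0 \<delta> t"
proof -
  have "0 \<le> 26 * enn2real (pw_functional v S \<nu> t) + 10 * norm (v t) * sqrt (ln (2 * sqrt 2 / \<delta>))"
    using one_le_increment_threshold[OF assms(5,6)] by simp
  also note gaussian_envelope_ge[OF assms]
  finally show ?thesis .
qed

lemma gaussian_envelope_admissible:
  fixes v :: "'s \<Rightarrow> 'h::euclidean_space"
  assumes fin: "finite S" and sup: "sup_functional v S \<nu> < \<infinity>"
    and env: "26 \<le> C" "0 < r\<^sub>0" "0 < s\<^sub>0" "s\<^sub>0 \<le> sup_radius v S" "0 < \<delta>" "\<delta> < 1"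
  shows "1 - \<delta> \<le> \<P>(z in std_gaussian. \<forall>t\<in>S. \<bar>z \<bullet> v t\<bar> \<le> gaussian_envelope C v S \<nu> r\<^sub>0 s\<^sub>0 \<delta> t)"
proof -
  interpret prob_space "std_gaussian :: 'h measure" by (rule prob_space_std_gaussian)
  note K = one_le_increment_threshold[OF env(5,6)]
  have "1 - \<delta> \<le> \<P>(z in std_gaussian. increment_moment v S \<nu> z \<le> 2 * sqrt 2 / \<delta>)"
    by (rule prob_increment_moment_le[OF fin env(5)])
  also have "\<dots> \<le> \<P>(z in std_gaussian. \<forall>t\<in>S. \<bar>z \<bullet> v t\<bar> \<le> gaussian_envelope C v S \<nu> r\<^sub>0 s\<^sub>0 \<delta> t)"
  proof (rule finite_measure_mono)
    show "{z \<in> space std_gaussian. \<forall>t\<in>S. \<bar>z \<bullet> v t\<bar> \<le> gaussian_envelope C v S \<nu> r\<^sub>0 s\<^sub>0 \<delta> t} \<in> events"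
      using fin by measurable
    show "{z \<in> space std_gaussian. increment_moment v S \<nu> z \<le> 2 * sqrt 2 / \<delta>}
        \<subseteq> {z \<in> space std_gaussian. \<forall>t\<in>S. \<bar>z \<bullet> v t\<bar> \<le> gaussian_envelope C v S \<nu> r\<^sub>0 s\<^sub>0 \<delta> t}"
    \<comment> \<open>The event on the left does not mention \<open>t\<close>, so one event serves
      all points at once.\<close>
    proof safe
      fix z t assume z: "increment_moment v S \<nu> z \<le> 2 * sqrt 2 / \<delta>" and t: "t \<in> S"
      show "\<bar>z \<bullet> v t\<bar> \<le> gaussian_envelope C v S \<nu> r\<^sub>0 s\<^sub>0 \<delta> t"
      proof (cases "v t = 0")
        \<comment> \<open>Here the process vanishes, while \<open>chaining_bound\<close> asks for a
          positive \<open>norm (v t)\<close>.\<close>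
        case True
        then show ?thesis using gaussian_envelope_nonneg[OF env] by simp
      next
        case False
        have "pw_functional v S \<nu> t \<le> sup_functional v S \<nu>"
          unfolding sup_functional_def by (rule SUP_upper[OF t])
        then have "pw_functional v S \<nu> t < \<infinity>"
          using sup by (rule le_less_trans)
        then show ?thesis
          using chaining_bound[OF fin _ _ z K, of t] gaussian_envelope_ge[OF env] False
          by (meson order_trans zero_less_norm_iff)
      qed
    qed
  qed
  finally show ?thesis .
qed

section \<open>The anchored prior\<close>

lemma dball_prob_measurable [measurable]:
  "(\<lambda>\<epsilon>. measure_pmf.prob \<nu> (dball v S t \<epsilon>)) \<in> borel_measurable borel"
  by (intro borel_measurable_mono monoI measure_pmf.finite_measure_mono dball_mono) auto

lemma sqrt_log_inv_measurable [measurable]: "sqrt_log_inv \<in> borel_measurable borel"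
  unfolding sqrt_log_inv_def[abs_def] by measurable

lemma prob_anchored_prior:
  "measure_pmf.prob (anchored_prior v T \<mu>) B =
     indicator B (anchor v T) / 2 + measure_pmf.prob (map_pmf Some \<mu>) B / 2"
proof -
  have "emeasure (measure_pmf (anchored_prior v T \<mu>)) B
      = ennreal (1 / 2) * ennreal (indicator B (anchor v T))
        + ennreal (1 / 2) * ennreal (measure_pmf.prob (map_pmf Some \<mu>) B)"
    unfolding anchored_prior_def emeasure_bind_pmf
    by (subst nn_integral_bernoulli_pmf)
      (simp_all add: measure_pmf.emeasure_eq_measure mult.commute split: split_indicator
        del: emeasure_map_pmf measure_map_pmf)
  also have "\<dots> = ennreal (1 / 2 * indicator B (anchor v T) + 1 / 2 * measure_pmf.prob (map_pmf Some \<mu>) B)"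
    by (subst ennreal_plus) (simp_all only: ennreal_mult' mult_nonneg_nonneg measure_nonneg indicator_pos_le
      zero_le_divide_1_iff zero_le_numeral)
  finally show ?thesis
    unfolding measure_pmf.emeasure_eq_measure by (subst (asm) ennreal_inj) auto
qed

lemma set_pmf_anchored_prior: "set_pmf (anchored_prior v T \<mu>) \<subseteq> insert (anchor v T) (Some ` set_pmf \<mu>)"
  by (auto simp: anchored_prior_def split: if_splits)

text \<open>If \<open>v\<close> has a zero in \<open>T\<close>, injectivity makes it unique, so the
  definite description in \<open>anchor\<close> denotes it.\<close>

lemma anchored_map_anchor: "anchored_map v (anchor v T) = 0" if "inj_on v T"
proof (cases "\<exists>t\<in>T. v t = 0")
  case True
  then have "\<exists>!t. t \<in> T \<and> v t = 0"
    using that by (metis inj_onD)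
  from theI'[OF this] have "v (THE t. t \<in> T \<and> v t = 0) = 0"
    by simp
  then show ?thesis
    using True by (simp add: anchored_map_def anchor_def)
qed (simp add: anchored_map_def anchor_def)

text \<open>Halving the mass adds ln 2 under the root, and the root is subadditive. For
  \<open>p = 0\<close> the right-hand side is infinite.\<close>

lemma sqrt_log_inv_half_le: "sqrt_log_inv q \<le> sqrt_log_inv p + ennreal (sqrt (ln 2))"
  if "p / 2 \<le> q" "0 \<le> p" "q \<le> 1" "p \<le> 1"
proof (cases "p = 0")
  case False
  then have p: "0 < p" and q: "0 < q" using that by auto
  have "ln (1 / q) \<le> ln (1 / p * 2)"
    using p q that by (intro ln_mono) (auto simp: field_simps)
  also have "\<dots> = ln (1 / p) + ln 2"
    using p by (simp add: ln_div)
  finally have "sqrt (ln (1 / q)) \<le> sqrt (ln (1 / p) + ln 2)"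
    by simp
  also have "\<dots> \<le> sqrt (ln (1 / p)) + sqrt (ln 2)"
    using p that by (intro sqrt_add_le_add_sqrt ln_ge_zero) auto
  finally have "sqrt (ln (1 / q)) \<le> sqrt (ln (1 / p)) + sqrt (ln 2)" .
  then show ?thesis
    using p q that by (simp add: sqrt_log_inv_def ennreal_leI flip: ennreal_plus)
qed (simp add: sqrt_log_inv_def)

text \<open>The pointwise loss \<open>sqrt (ln 2)\<close> is integrated over an interval of length
  \<open>4 * norm (v t)\<close>.\<close>

lemma pw_functional_half_le:
  assumes half: "\<And>B. measure_pmf.prob \<mu> B / 2 \<le> measure_pmf.prob \<nu> B"
  shows "pw_functional v S \<nu> t \<le> pw_functional v S \<mu> t + ennreal (4 * sqrt (ln 2) * norm (v t))"
proof -
  have "pw_functional v S \<nu> t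
      \<le> (\<integral>\<^sup>+\<epsilon>. sqrt_log_inv (measure_pmf.prob \<mu> (dball v S t \<epsilon>)) * indicator {0..4 * norm (v t)} \<epsilon>
          + ennreal (sqrt (ln 2)) * indicator {0..4 * norm (v t)} \<epsilon> \<partial>lborel)"
    unfolding pw_functional_def
    by (rule nn_integral_mono)
      (auto intro!: sqrt_log_inv_half_le half split: split_indicator)
  also have "\<dots> = pw_functional v S \<mu> t + (\<integral>\<^sup>+\<epsilon>. ennreal (sqrt (ln 2)) * indicator {0..4 * norm (v t)} \<epsilon> \<partial>lborel)"
    unfolding pw_functional_def by (rule nn_integral_add) measurable
  also have "(\<integral>\<^sup>+\<epsilon>. ennreal (sqrt (ln 2)) * indicator {0..4 * norm (v t)} \<epsilon> \<partial>lborel)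
      = ennreal (4 * sqrt (ln 2) * norm (v t))"
    by (subst nn_integral_cmult_indicator) (simp_all add: ennreal_mult'[symmetric] mult_ac)
  finally show ?thesis .
qed

text \<open>Only balls of radius below \<open>norm (v t)\<close> avoid the anchor. The range beyond is recovered from the
  substitution \<open>\<epsilon> = 4 x\<close> and monotonicity of the integrand, at the price of the factor 4.\<close>

lemma pw_functional_le_4:
  assumes le: "\<And>\<epsilon>. \<epsilon> < norm (v t) \<Longrightarrow>
    measure_pmf.prob \<nu> (dball v S t \<epsilon>) \<le> measure_pmf.prob \<mu> (dball v S t \<epsilon>)"
  shows "pw_functional v S \<mu> t \<le> 4 * pw_functional v S \<nu> t"
proof -
  define f where "f \<epsilon> = sqrt_log_inv (measure_pmf.prob \<mu> (dball v S t \<epsilon>))" for \<epsilon>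
  have [measurable]: "f \<in> borel_measurable borel"
    unfolding f_def[abs_def] by measurable
  have anti: "f y \<le> f x" if "x \<le> y" for x y
    unfolding f_def using that by (rule sqrt_log_inv_dball_antimono)
  have "pw_functional v S \<mu> t = (\<integral>\<^sup>+\<epsilon>. f \<epsilon> * indicator {0..4 * norm (v t)} \<epsilon> \<partial>lborel)"
    by (simp add: pw_functional_def f_def)
  also have "\<dots> = 4 * (\<integral>\<^sup>+x. f (4 * x) * indicator {0..4 * norm (v t)} (4 * x) \<partial>lborel)"
    using nn_integral_real_affine[of "\<lambda>\<epsilon>. f \<epsilon> * indicator {0..4 * norm (v t)} \<epsilon>" 4 0] by simp
  also have "(\<integral>\<^sup>+x. f (4 * x) * indicator {0..4 * norm (v t)} (4 * x) \<partial>lborel) \<le> pw_functional v S \<nu> t"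
    unfolding pw_functional_def
  proof (rule nn_integral_mono_AE)
    \<comment> \<open>The masses are compared at radii strictly below \<open>norm (v t)\<close>,
      whereas the rescaled interval is closed; its endpoint is a null set.\<close>
    have "AE x in lborel. x \<noteq> norm (v t)"
      by (rule AE_lborel_singleton)
    then show "AE x in lborel. f (4 * x) * indicator {0..4 * norm (v t)} (4 * x)
        \<le> sqrt_log_inv (measure_pmf.prob \<nu> (dball v S t x)) * indicator {0..4 * norm (v t)} x"
    proof eventually_elim
      case (elim x)
      show ?case
      proof (cases "0 \<le> x \<and> x < norm (v t)")
        case True
        then have "f (4 * x) \<le> f x" by (intro anti) simp
        also have "f x \<le> sqrt_log_inv (measure_pmf.prob \<nu> (dball v S t x))"
          unfolding f_def using True by (intro sqrt_log_inv_antimono le) auto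
        finally show ?thesis using True by simp
      qed (use elim in \<open>auto simp: indicator_def\<close>)
    qed
  qed
  finally show ?thesis
    by (simp add: mult_left_mono)
qed

text \<open>The extended prior keeps at least half the mass of every set, which gives the first
  bound. A ball around \<open>t\<close> of radius below \<open>norm (v t)\<close> misses the anchor,
  so its mass does not increase there, which gives the second.\<close>

lemma pw_functional_anchored_prior:
  assumes "inj_on v T"
  shows "pw_functional (anchored_map v) S (anchored_prior v T \<mu>) (Some t)
      \<le> pw_functional (anchored_map v) S (map_pmf Some \<mu>) (Some t) + ennreal (4 * sqrt (ln 2) * norm (v t))"
    and "pw_functional (anchored_map v) S (map_pmf Some \<mu>) (Some t)
      \<le> 4 * pw_functional (anchored_map v) S (anchored_prior v T \<mu>) (Some t)"
proof -
  have v: "anchored_map v (Some t) = v t"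
    by (simp add: anchored_map_def)
  show "pw_functional (anchored_map v) S (anchored_prior v T \<mu>) (Some t)
      \<le> pw_functional (anchored_map v) S (map_pmf Some \<mu>) (Some t) + ennreal (4 * sqrt (ln 2) * norm (v t))"
    unfolding v[symmetric] by (rule pw_functional_half_le) (simp add: prob_anchored_prior)
  show "pw_functional (anchored_map v) S (map_pmf Some \<mu>) (Some t)
      \<le> 4 * pw_functional (anchored_map v) S (anchored_prior v T \<mu>) (Some t)"
  proof (rule pw_functional_le_4)
    fix \<epsilon> assume "\<epsilon> < norm (anchored_map v (Some t))"
    then have "anchor v T \<notin> dball (anchored_map v) S (Some t) \<epsilon>"
      using anchored_map_anchor[OF assms] by (simp add: dball_def)
    then show "measure_pmf.prob (anchored_prior v T \<mu>) (dball (anchored_map v) S (Some t) \<epsilon>)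
        \<le> measure_pmf.prob (map_pmf Some \<mu>) (dball (anchored_map v) S (Some t) \<epsilon>)"
      by (simp add: prob_anchored_prior)
  qed
qed

section \<open>Decoding risk\<close>

text \<open>The penalties cancel when the two inequalities are added.\<close>

lemma residual_comparison_penalized:
  fixes \<Omega> :: "'t \<Rightarrow> real"
  assumes "integrable M \<epsilon>opt" "integrable M \<epsilon>pen"
    and "AE \<omega> in M. 0 \<le> \<epsilon>opt \<omega>" "AE \<omega> in M. 0 \<le> \<epsilon>pen \<omega>"
    and "AE \<omega> in M. (norm (Y \<omega> - v (dec (Y \<omega>))))\<^sup>2 + \<Omega> (dec (Y \<omega>))
           \<le> (norm (Y \<omega> - v (\<Theta> \<omega>)))\<^sup>2 + \<Omega> (\<Theta> \<omega>) + \<epsilon>opt \<omega>"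
    and "AE \<omega> in M. \<Omega> (dec (Y \<omega>)) \<ge> \<Omega> (\<Theta> \<omega>) - \<epsilon>pen \<omega>"
  shows "residual_comparison M v \<Theta> Y dec (\<lambda>\<omega>. \<epsilon>opt \<omega> + \<epsilon>pen \<omega>)"
proof -
  have "AE \<omega> in M. 0 \<le> \<epsilon>opt \<omega> + \<epsilon>pen \<omega>"
    using assms(3,4) by eventually_elim simp
  moreover have "AE \<omega> in M. (norm (Y \<omega> - v (dec (Y \<omega>))))\<^sup>2 \<le> (norm (Y \<omega> - v (\<Theta> \<omega>)))\<^sup>2 + (\<epsilon>opt \<omega> + \<epsilon>pen \<omega>)"
    using assms(5,6) by eventually_elim simp
  ultimately show ?thesis
    using assms(1,2) by (simp add: residual_comparison_def)
qed

text \<open>Here \<open>x\<close> is the true point, \<open>y\<close> the decoded one and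
  \<open>z\<close> the noise. The noise energy cancels on both sides, and the remaining cross term
  is bounded by the envelope values at the two points.\<close>

lemma dist_decoded_le:
  fixes z :: "'h::real_inner"
  assumes "(norm (x + \<tau> *\<^sub>R z - y))\<^sup>2 \<le> (norm (\<tau> *\<^sub>R z))\<^sup>2 + \<epsilon>"
    and "0 \<le> \<tau>" "\<bar>z \<bullet> x\<bar> \<le> a" "\<bar>z \<bullet> y\<bar> \<le> b"
  shows "(dist x y)\<^sup>2 \<le> 2 * \<tau> * (a + b) + \<epsilon>"
proof -
  have "(norm (x + \<tau> *\<^sub>R z - y))\<^sup>2 = (norm (\<tau> *\<^sub>R z))\<^sup>2 + 2 * \<tau> * (z \<bullet> x - z \<bullet> y) + (dist x y)\<^sup>2"
    unfolding dist_norm power2_norm_eq_inner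
    by (simp add: inner_commute algebra_simps)
  then have "(dist x y)\<^sup>2 \<le> 2 * \<tau> * (z \<bullet> y - z \<bullet> x) + \<epsilon>"
    using assms(1) by (simp add: algebra_simps)
  also have "2 * \<tau> * (z \<bullet> y - z \<bullet> x) \<le> 2 * \<tau> * (a + b)"
    using assms(2-4) by (intro mult_left_mono) auto
  finally show ?thesis by simp
qed

text \<open>The envelope event concerns \<open>Z\<close> alone and is uniform over \<open>T\<close>,
  so it also controls the index chosen by the decoder in dependence on the noise.\<close>

lemma decoder_risk_bounds:
  fixes v :: "'t \<Rightarrow> 'h::euclidean_space" and A :: "'t \<Rightarrow> real"
  assumes M: "prob_space M" and T: "finite T" and \<pi>: "set_pmf \<pi> \<subseteq> T" and \<tau>: "0 \<le> \<tau>" and \<delta>: "0 \<le> \<delta>"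
    and \<Theta>: "\<Theta> \<in> M \<rightarrow>\<^sub>M count_space UNIV" "distr M (count_space UNIV) \<Theta> = measure_pmf \<pi>"
    and Z: "Z \<in> M \<rightarrow>\<^sub>M borel" "distr M borel Z = std_gaussian"
    and Y: "\<And>\<omega>. \<omega> \<in> space M \<Longrightarrow> Y \<omega> = v (\<Theta> \<omega>) + \<tau> *\<^sub>R Z \<omega>"
    and dec: "dec \<in> borel \<rightarrow>\<^sub>M count_space T"
    and res: "residual_comparison M v \<Theta> Y dec \<epsilon>up"
    and env: "\<P>(z in std_gaussian. \<forall>t\<in>T. \<bar>z \<bullet> v t\<bar> \<le> A t) \<ge> 1 - \<delta>"
  shows "\<P>(\<omega> in M. (dist (v (\<Theta> \<omega>)) (v (dec (Y \<omega>))))\<^sup>2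
             \<le> 2 * \<tau> * (A (\<Theta> \<omega>) + A (dec (Y \<omega>))) + \<epsilon>up \<omega>) \<ge> 1 - \<delta>" (is ?prob)
    and "(\<integral>\<^sup>+\<omega>. ennreal (dist (v (\<Theta> \<omega>)) (v (dec (Y \<omega>)))) \<partial>M)
        \<le> (\<integral>\<^sup>+\<omega>. ennreal (sqrt (2 * \<tau> * (A (\<Theta> \<omega>) + A (dec (Y \<omega>))) + \<epsilon>up \<omega>)) \<partial>M)
           + ennreal (\<delta> * diameter (v ` T))" (is ?risk)
proof -
  interpret prob_space M by (rule M)
  define d where "d \<omega> = dist (v (\<Theta> \<omega>)) (v (dec (Y \<omega>)))" for \<omega>
  define b where "b \<omega> = 2 * \<tau> * (A (\<Theta> \<omega>) + A (dec (Y \<omega>))) + \<epsilon>up \<omega>" for \<omega>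
  note [measurable] = \<Theta>(1) Z(1) dec
  have [measurable]: "(\<lambda>\<omega>. f (\<Theta> \<omega>)) \<in> borel_measurable M" for f :: "'t \<Rightarrow> 'b::topological_space"
    by (rule measurable_compose[OF \<Theta>(1)]) simp
  have [measurable]: "Y \<in> borel_measurable M"
    by (subst measurable_cong[OF Y]) measurable
  have [measurable]: "(\<lambda>\<omega>. f (dec (Y \<omega>))) \<in> borel_measurable M" for f :: "'t \<Rightarrow> 'b::topological_space"
    by (rule measurable_compose[OF measurable_compose[OF _ dec]]) auto
  have [measurable]: "\<epsilon>up \<in> borel_measurable M"
    using res by (simp add: residual_comparison_def)
  have d_meas [measurable]: "d \<in> borel_measurable M"
    unfolding d_def[abs_def] by measurable
  have b_meas [measurable]: "b \<in> borel_measurable M"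
    unfolding b_def[abs_def] by measurable
  have "AE t in distr M (count_space UNIV) \<Theta>. t \<in> T"
    unfolding \<Theta>(2) using \<pi> by (auto simp: AE_measure_pmf_iff)
  then have AE_\<Theta>: "AE \<omega> in M. \<Theta> \<omega> \<in> T"
    by (subst (asm) AE_distr_iff) auto
  \<comment> \<open>The target space \<open>count_space T\<close> forces this for every
    \<open>y\<close>, whereas \<open>\<Theta>\<close> lies in \<open>T\<close> only almost
    surely.\<close>
  have dec_T: "dec y \<in> T" for y
    using measurable_space[OF dec, of y] by simp
  have AE_res: "AE \<omega> in M. (norm (Y \<omega> - v (dec (Y \<omega>))))\<^sup>2 \<le> (norm (Y \<omega> - v (\<Theta> \<omega>)))\<^sup>2 + \<epsilon>up \<omega>"
    using res by (simp add: residual_comparison_def)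
  have good_meas: "{z \<in> space borel. \<forall>t\<in>T. \<bar>z \<bullet> v t\<bar> \<le> A t} \<in> sets borel"
    using T by measurable
  have "1 - \<delta> \<le> measure (distr M borel Z) {z \<in> space borel. \<forall>t\<in>T. \<bar>z \<bullet> v t\<bar> \<le> A t}"
    using env by (simp add: Z(2))
  also have "\<dots> = \<P>(\<omega> in M. \<forall>t\<in>T. \<bar>Z \<omega> \<bullet> v t\<bar> \<le> A t)"
    by (subst measure_distr[OF Z(1) good_meas]) (auto intro!: arg_cong[of _ _ prob])
  also have "\<dots> \<le> \<P>(\<omega> in M. (d \<omega>)\<^sup>2 \<le> b \<omega>)"
  proof (rule finite_measure_mono_AE)
    show "AE \<omega> in M. \<omega> \<in> {\<omega> \<in> space M. \<forall>t\<in>T. \<bar>Z \<omega> \<bullet> v t\<bar> \<le> A t}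
        \<longrightarrow> \<omega> \<in> {\<omega> \<in> space M. (d \<omega>)\<^sup>2 \<le> b \<omega>}"
      using AE_res AE_\<Theta> AE_space
    proof eventually_elim
      case (elim \<omega>)
      then show ?case
        using dist_decoded_le[of "v (\<Theta> \<omega>)" \<tau> "Z \<omega>" "v (dec (Y \<omega>))" "\<epsilon>up \<omega>" "A (\<Theta> \<omega>)" "A (dec (Y \<omega>))"]
          \<tau> dec_T[of "Y \<omega>"] Y[of \<omega>] by (simp add: d_def b_def)
    qed
  qed measurable
  finally have good: "1 - \<delta> \<le> \<P>(\<omega> in M. (d \<omega>)\<^sup>2 \<le> b \<omega>)" .
  then show ?prob
    by (simp add: d_def b_def)
  \<comment> \<open>The bad event. Off \<open>E\<close> the distance is at most
    \<open>sqrt (b \<omega>)\<close>; on \<open>E\<close> it is almost surely at most the diameter,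
    which costs \<delta> times the diameter in expectation.\<close>
  define E where "E = {\<omega> \<in> space M. \<not> (d \<omega>)\<^sup>2 \<le> b \<omega>}"
  have [measurable]: "E \<in> sets M"
    unfolding E_def by measurable
  have "prob E = 1 - \<P>(\<omega> in M. (d \<omega>)\<^sup>2 \<le> b \<omega>)"
    unfolding E_def by (rule prob_neg) measurable
  then have E: "prob E \<le> \<delta>"
    using good by simp
  have diam: "0 \<le> diameter (v ` T)"
    using T by (intro diameter_ge_0) (simp add: finite_imp_bounded)
  have "(\<integral>\<^sup>+\<omega>. ennreal (d \<omega>) \<partial>M)
      \<le> (\<integral>\<^sup>+\<omega>. ennreal (sqrt (b \<omega>)) + ennreal (diameter (v ` T)) * indicator E \<omega> \<partial>M)"
  proof (rule nn_integral_mono_AE)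
    show "AE \<omega> in M. ennreal (d \<omega>) \<le> ennreal (sqrt (b \<omega>)) + ennreal (diameter (v ` T)) * indicator E \<omega>"
      using AE_\<Theta> AE_space
    proof eventually_elim
      case (elim \<omega>)
      show ?case
      proof (cases "\<omega> \<in> E")
        case True
        have "d \<omega> \<le> diameter (v ` T)"
          unfolding d_def using T elim(1) dec_T
          by (intro diameter_bounded_bound) (auto simp: finite_imp_bounded)
        then show ?thesis
          using True by (simp add: ennreal_leI add_increasing)
      next
        case False
        then have "d \<omega> \<le> sqrt (b \<omega>)"
          using elim(2) by (intro real_le_rsqrt) (simp add: E_def)
        then show ?thesis
          using False by (simp add: ennreal_leI)
      qed
    qed
  qed
  also have "\<dots> = (\<integral>\<^sup>+\<omega>. ennreal (sqrt (b \<omega>)) \<partial>M) + ennreal (diameter (v ` T)) * emeasure M E"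
    by (subst nn_integral_add) (auto simp: nn_integral_cmult_indicator)
  also have "ennreal (diameter (v ` T)) * emeasure M E \<le> ennreal (\<delta> * diameter (v ` T))"
    using E \<delta> diam by (simp add: emeasure_eq_measure ennreal_mult'[symmetric] mult.commute[of "diameter _"] mult_right_mono ennreal_leI)
  finally show ?risk
    by (simp add: d_def b_def)
qed

theorem corollary1p6:
  fixes T :: "'t set" and v :: "'t \<Rightarrow> 'h::euclidean_space" and \<pi> :: "'t pmf"
    and M :: "'w measure" and \<Theta> :: "'w \<Rightarrow> 't" and Z Y :: "'w \<Rightarrow> 'h"
    and dec :: "'h \<Rightarrow> 't" and \<tau> \<delta> :: real
  assumes "finite T" and "inj_on v T" and "set_pmf \<pi> \<subseteq> T"
    and "0 < \<tau>" and "0 < \<delta>" and "\<delta> < 1"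
    and "prob_space M"
    and "\<Theta> \<in> M \<rightarrow>\<^sub>M count_space UNIV" and "distr M (count_space UNIV) \<Theta> = measure_pmf \<pi>"
    and "Z \<in> M \<rightarrow>\<^sub>M borel" and "distr M borel Z = std_gaussian"
    and "prob_space.indep_set M {\<Theta> -` B \<inter> space M | B. B \<in> sets (count_space UNIV)}
                                 {Z -` B \<inter> space M | B. B \<in> sets borel}"
    and "\<And>\<omega>. \<omega> \<in> space M \<Longrightarrow> Y \<omega> = v (\<Theta> \<omega>) + \<tau> *\<^sub>R Z \<omega>"
    and "dec \<in> borel \<rightarrow>\<^sub>M count_space T"
  shows "
       \<comment> \<open>penalized decoders satisfy the residual comparison\<close>
      (\<forall>\<Omega> :: 't \<Rightarrow> real. \<forall>\<epsilon>opt \<epsilon>pen :: 'w \<Rightarrow> real.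
       integrable M \<epsilon>opt \<longrightarrow> integrable M \<epsilon>pen \<longrightarrow>
       (AE \<omega> in M. 0 \<le> \<epsilon>opt \<omega>) \<longrightarrow> (AE \<omega> in M. 0 \<le> \<epsilon>pen \<omega>) \<longrightarrow>
       (AE \<omega> in M. (norm (Y \<omega> - v (dec (Y \<omega>))))\<^sup>2 + \<Omega> (dec (Y \<omega>))
                     \<le> (norm (Y \<omega> - v (\<Theta> \<omega>)))\<^sup>2 + \<Omega> (\<Theta> \<omega>) + \<epsilon>opt \<omega>) \<longrightarrow>
       (AE \<omega> in M. \<Omega> (dec (Y \<omega>)) \<ge> \<Omega> (\<Theta> \<omega>) - \<epsilon>pen \<omega>) \<longrightarrow>
       residual_comparison M v \<Theta> Y dec (\<lambda>\<omega>. \<epsilon>opt \<omega> + \<epsilon>pen \<omega>)) \<and>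
       \<comment> \<open>high-probability and expectation bounds for a general envelope\<close>
      (\<forall>(\<epsilon>up :: 'w \<Rightarrow> real) (A :: 't \<Rightarrow> real).
       residual_comparison M v \<Theta> Y dec \<epsilon>up \<longrightarrow>
       (\<forall>t\<in>T. 0 \<le> A t) \<longrightarrow>
       \<P>(z in std_gaussian. \<forall>t\<in>T. \<bar>z \<bullet> v t\<bar> \<le> A t) \<ge> 1 - \<delta> \<longrightarrow>
       \<P>(\<omega> in M. (dist (v (\<Theta> \<omega>)) (v (dec (Y \<omega>))))\<^sup>2
                     \<le> 2 * \<tau> * (A (\<Theta> \<omega>) + A (dec (Y \<omega>))) + \<epsilon>up \<omega>) \<ge> 1 - \<delta> \<and>
       (\<integral>\<^sup>+\<omega>. ennreal (dist (v (\<Theta> \<omega>)) (v (dec (Y \<omega>)))) \<partial>M)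
         \<le> (\<integral>\<^sup>+\<omega>. ennreal (sqrt (2 * \<tau> * (A (\<Theta> \<omega>) + A (dec (Y \<omega>))) + \<epsilon>up \<omega>)) \<partial>M)
            + ennreal (\<delta> * diameter (v ` T))) \<and>
       \<comment> \<open>the pointwise Gaussian envelope is admissible, for every prior on the anchored set;
        the numeral makes the constant absolute, i.e. independent of the types\<close>
      (\<forall>C \<ge> 100. \<forall>(\<nu> :: 't option pmf) (r\<^sub>0 :: real) (s\<^sub>0 :: real).
       set_pmf \<nu> \<subseteq> anchored_set v T \<longrightarrow>
       0 < sup_radius (anchored_map v) (anchored_set v T) \<longrightarrow>
       sup_functional (anchored_map v) (anchored_set v T) \<nu> < \<infinity> \<longrightarrow>
       0 < r\<^sub>0 \<longrightarrow> 0 < s\<^sub>0 \<longrightarrow> s\<^sub>0 \<le> sup_radius (anchored_map v) (anchored_set v T) \<longrightarrow>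
       (let A\<^sub>0 = gaussian_envelope C (anchored_map v) (anchored_set v T) \<nu> r\<^sub>0 s\<^sub>0 \<delta>;
            A = (\<lambda>t. A\<^sub>0 (Some t))
        in (\<forall>t\<in>anchored_set v T. 0 \<le> A\<^sub>0 t) \<and>
           \<P>(z in std_gaussian. \<forall>t\<in>anchored_set v T. \<bar>z \<bullet> anchored_map v t\<bar> \<le> A\<^sub>0 t) \<ge> 1 - \<delta> \<and>
           (\<forall>\<epsilon>up :: 'w \<Rightarrow> real. residual_comparison M v \<Theta> Y dec \<epsilon>up \<longrightarrow>
             \<P>(\<omega> in M. (dist (v (\<Theta> \<omega>)) (v (dec (Y \<omega>))))\<^sup>2
                           \<le> 2 * \<tau> * (A (\<Theta> \<omega>) + A (dec (Y \<omega>))) + \<epsilon>up \<omega>) \<ge> 1 - \<delta> \<and>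
             (\<integral>\<^sup>+\<omega>. ennreal (dist (v (\<Theta> \<omega>)) (v (dec (Y \<omega>)))) \<partial>M)
               \<le> (\<integral>\<^sup>+\<omega>. ennreal (sqrt (2 * \<tau> * (A (\<Theta> \<omega>) + A (dec (Y \<omega>))) + \<epsilon>up \<omega>)) \<partial>M)
                  + ennreal (\<delta> * diameter (v ` T))))) \<and>
       \<comment> \<open>the extended prior is such a prior, and changes the functional by universal constants\<close>
      (\<forall>\<mu> :: 't pmf. set_pmf \<mu> \<subseteq> T \<longrightarrow>
       set_pmf (anchored_prior v T \<mu>) \<subseteq> anchored_set v T \<and>
       (\<forall>t\<in>T.
         pw_functional (anchored_map v) (anchored_set v T) (anchored_prior v T \<mu>) (Some t)
           \<le> pw_functional (anchored_map v) (anchored_set v T) (map_pmf Some \<mu>) (Some t)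
              + ennreal (4 * sqrt (ln 2) * norm (v t)) \<and>
         pw_functional (anchored_map v) (anchored_set v T) (map_pmf Some \<mu>) (Some t)
           \<le> 4 * pw_functional (anchored_map v) (anchored_set v T) (anchored_prior v T \<mu>) (Some t)))"
proof -
  note risk = decoder_risk_bounds[OF assms(7,1,3) less_imp_le[OF assms(4)] less_imp_le[OF assms(5)] assms(8-11,13,14)]
  show ?thesis
  proof (intro conjI, goal_cases)
    case 1
    show ?case
      by (intro allI impI) (rule residual_comparison_penalized)
  next
    case 2
    show ?case
      by (intro allI impI conjI risk)
  next
    case 3
    let ?S = "anchored_set v T" and ?v = "anchored_map v"
    have fin: "finite ?S"
      using assms(1) by (simp add: anchored_set_def)
    show ?case
      unfolding Let_def
    proof (intro allI impI)
      fix C r\<^sub>0 s\<^sub>0 :: real and \<nu> :: "'t option pmf"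
      assume C: "100 \<le> C" and sup: "sup_functional ?v ?S \<nu> < \<infinity>"
        and rs: "0 < r\<^sub>0" "0 < s\<^sub>0" "s\<^sub>0 \<le> sup_radius ?v ?S"
      define A\<^sub>0 where "A\<^sub>0 = gaussian_envelope C ?v ?S \<nu> r\<^sub>0 s\<^sub>0 \<delta>"
      \<comment> \<open>Chaining yields the constant 26, and the stated 100 leaves room.\<close>
      have C': "26 \<le> C" using C by simp
      note env = C' rs assms(5,6)
      have adm: "1 - \<delta> \<le> \<P>(z in std_gaussian. \<forall>t\<in>?S. \<bar>z \<bullet> ?v t\<bar> \<le> A\<^sub>0 t)"
        unfolding A\<^sub>0_def by (rule gaussian_envelope_admissible[OF fin sup env])
      \<comment> \<open>Restricting to the points \<open>Some t\<close> with \<open>t\<close> in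
        \<open>T\<close> weakens the event, and there the anchored map is \<open>v\<close>.\<close>
      also have "\<dots> \<le> \<P>(z in std_gaussian. \<forall>t\<in>T. \<bar>z \<bullet> v t\<bar> \<le> A\<^sub>0 (Some t))"
      proof (rule finite_measure.finite_measure_mono[OF prob_space.finite_measure[OF prob_space_std_gaussian]])
        show "{z \<in> space std_gaussian. \<forall>t\<in>?S. \<bar>z \<bullet> ?v t\<bar> \<le> A\<^sub>0 t}
            \<subseteq> {z \<in> space std_gaussian. \<forall>t\<in>T. \<bar>z \<bullet> v t\<bar> \<le> A\<^sub>0 (Some t)}"
          by (force simp: anchored_set_def anchored_map_def)
        show "{z \<in> space std_gaussian. \<forall>t\<in>T. \<bar>z \<bullet> v t\<bar> \<le> A\<^sub>0 (Some t)} \<in> sets std_gaussian"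
          using assms(1) by measurable
      qed
      finally have adm_T: "1 - \<delta> \<le> \<P>(z in std_gaussian. \<forall>t\<in>T. \<bar>z \<bullet> v t\<bar> \<le> A\<^sub>0 (Some t))" .
      have "\<forall>t\<in>?S. 0 \<le> A\<^sub>0 t"
        unfolding A\<^sub>0_def by (intro ballI gaussian_envelope_nonneg env)
      then show "(\<forall>t\<in>?S. 0 \<le> gaussian_envelope C ?v ?S \<nu> r\<^sub>0 s\<^sub>0 \<delta> t) \<and>
          1 - \<delta> \<le> \<P>(z in std_gaussian. \<forall>t\<in>?S. \<bar>z \<bullet> ?v t\<bar> \<le> gaussian_envelope C ?v ?S \<nu> r\<^sub>0 s\<^sub>0 \<delta> t) \<and>
          (\<forall>\<epsilon>up. residual_comparison M v \<Theta> Y dec \<epsilon>up \<longrightarrow>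
            1 - \<delta> \<le> \<P>(\<omega> in M. (dist (v (\<Theta> \<omega>)) (v (dec (Y \<omega>))))\<^sup>2
              \<le> 2 * \<tau> * (gaussian_envelope C ?v ?S \<nu> r\<^sub>0 s\<^sub>0 \<delta> (Some (\<Theta> \<omega>)) +
                  gaussian_envelope C ?v ?S \<nu> r\<^sub>0 s\<^sub>0 \<delta> (Some (dec (Y \<omega>)))) + \<epsilon>up \<omega>) \<and>
            (\<integral>\<^sup>+\<omega>. ennreal (dist (v (\<Theta> \<omega>)) (v (dec (Y \<omega>)))) \<partial>M)
              \<le> (\<integral>\<^sup>+\<omega>. ennreal (sqrt (2 * \<tau> * (gaussian_envelope C ?v ?S \<nu> r\<^sub>0 s\<^sub>0 \<delta> (Some (\<Theta> \<omega>)) +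
                  gaussian_envelope C ?v ?S \<nu> r\<^sub>0 s\<^sub>0 \<delta> (Some (dec (Y \<omega>)))) + \<epsilon>up \<omega>)) \<partial>M)
                + ennreal (\<delta> * diameter (v ` T)))"
        unfolding A\<^sub>0_def[symmetric]
        using adm by (intro conjI allI impI risk[OF _ _ adm_T])
    qed
  next
    case 4
    show ?case
    proof (intro allI impI conjI ballI)
      fix \<mu> :: "'t pmf" assume "set_pmf \<mu> \<subseteq> T"
      then show "set_pmf (anchored_prior v T \<mu>) \<subseteq> anchored_set v T"
        using set_pmf_anchored_prior[of v T \<mu>] by (auto simp: anchored_set_def)
    qed (rule pw_functional_anchored_prior[OF assms(2)])+
  qed
qed

end
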